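(* Let $\mathcal{C}$ be an extension-closed pseudovariety of finite groups, and suppose that $A$ and $B$ are $\mathcal{C}$-conjugacy separable groups. Then the restricted wreath product $A \wr B$ is $\mathcal{C}$-conjugacy separable if and only if at least one of the following is true: (1) $B \in \mathcal{C}$; (2) $A$ is abelian and $B$ is $\mathcal{C}$-cyclic subgroup separable.
   Context: An extension-closed pseudovariety of finite groups is a class $\mathcal{C}$ of finite groups closed under subgroups, finite direct products, quotients and extensions. For a group $G$, $\mathcal{N}_{\mathcal{C}}(G)$ denotes the set of normal subgroups $N$ of $G$ with $G/N \in \mathcal{C}$, and $\pi_N \colon G \to G/N$ is the projection. A subset $X \subseteq G$ is $\mathcal{C}$-separable in $G$ if for every $g \in G \setminus X$ there is $N \in \mathcal{N}_{\mathcal{C}}(G)$ with $\pi_N(g) \notin \pi_N(X)$. The group $G$ is $\mathcal{C}$-conjugacy separable if every conjugacy class of $G$ is $\mathcal{C}$-separable, and $\mathcal{C}$-cyclic subgroup separable if every cyclic subgroup of $G$ is $\mathcal{C}$-separable. The restricted wreath product is $A \wr B = \left(\bigoplus_{b \in B} A\right) \rtimes B$, where elements of $\bigoplus_{b\in B} A$ are finitely supported functions $f \colon B \to A$ and $B$ acts by $(b\cdot f)(x) = f(b^{-1}x)$.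
   Formalization: The "only if" direction is stated for nontrivial A only; for trivial A it is false (C the finite p-groups, A = 1, B = Z: the wreath product is Z, C-conjugacy separable, but neither (1) nor (2) holds). The "if" direction covers all A. *)

theory Defs
  imports "HOL-Algebra.Algebra"
begin

text \<open>
  A class of finite groups is given by a set \<open>C\<close> of groups with elements in \<open>nat\<close>. Every finite
  group is isomorphic to one of this type, so \<open>in_class\<close> makes \<open>C\<close> an isomorphism-closed
  class of groups over arbitrary types. The closure conditions below are stated with \<open>in_class\<close>
  because quotients and products live over other types; \<open>C\<close> itself need not be closed under
  isomorphism.
\<close>

definition in_class :: "nat monoid set \<Rightarrow> ('a, 'b) monoid_scheme \<Rightarrow> bool" where
  "in_class C G \<longleftrightarrow> group G \<and> (\<exists>H\<in>C. G \<cong> H)"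

text \<open>
  The product clause allows \<open>I = {}\<close>, so the class always contains the trivial group.
\<close>

definition ext_closed_pseudovariety :: "nat monoid set \<Rightarrow> bool" where
  "ext_closed_pseudovariety C \<longleftrightarrow>
     (\<forall>G\<in>C. group G \<and> finite (carrier G)) \<and>
     (\<forall>G\<in>C. \<forall>H. subgroup H G \<longrightarrow> in_class C (G\<lparr>carrier := H\<rparr>)) \<and>
     (\<forall>(I :: nat set) G. finite I \<and> (\<forall>i\<in>I. G i \<in> C) \<longrightarrow> in_class C (product_group I G)) \<and>
     (\<forall>G\<in>C. \<forall>N. N \<lhd> G \<longrightarrow> in_class C (G Mod N)) \<and>
     (\<forall>(G :: nat monoid) N.
        N \<lhd> G \<and> in_class C (G\<lparr>carrier := N\<rparr>) \<and> in_class C (G Mod N) \<longrightarrow> in_class C G)"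

definition class_normal :: "nat monoid set \<Rightarrow> ('a, 'b) monoid_scheme \<Rightarrow> 'a set set" where
  "class_normal C G = {N. N \<lhd> G \<and> in_class C (G Mod N)}"

text \<open>The projection of \<open>G\<close> onto \<open>G Mod N\<close> sends \<open>g\<close> to the coset \<open>N #>\<^bsub>G\<^esub> g\<close>.\<close>

definition class_separable ::
    "nat monoid set \<Rightarrow> ('a, 'b) monoid_scheme \<Rightarrow> 'a set \<Rightarrow> bool" where
  "class_separable C G S \<longleftrightarrow>
     S \<subseteq> carrier G \<and>
     (\<forall>g \<in> carrier G - S. \<exists>N \<in> class_normal C G.
        N #>\<^bsub>G\<^esub> g \<notin> (\<lambda>x. N #>\<^bsub>G\<^esub> x) ` S)"

definition conj_class :: "('a, 'b) monoid_scheme \<Rightarrow> 'a \<Rightarrow> 'a set" where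
  "conj_class G g = (\<lambda>h. h \<otimes>\<^bsub>G\<^esub> g \<otimes>\<^bsub>G\<^esub> inv\<^bsub>G\<^esub> h) ` carrier G"

definition conjugacy_separable :: "nat monoid set \<Rightarrow> ('a, 'b) monoid_scheme \<Rightarrow> bool" where
  "conjugacy_separable C G \<longleftrightarrow> (\<forall>g \<in> carrier G. class_separable C G (conj_class G g))"

definition cyclic_subgroup_separable ::
    "nat monoid set \<Rightarrow> ('a, 'b) monoid_scheme \<Rightarrow> bool" where
  "cyclic_subgroup_separable C G \<longleftrightarrow>
     (\<forall>g \<in> carrier G. class_separable C G (generate G {g}))"

definition shift ::
    "('b, 'c) monoid_scheme \<Rightarrow> 'b \<Rightarrow> ('b \<Rightarrow> 'a) \<Rightarrow> 'b \<Rightarrow> 'a" where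
  "shift B b f = (\<lambda>x\<in>carrier B. f (inv\<^bsub>B\<^esub> b \<otimes>\<^bsub>B\<^esub> x))"

text \<open>
  \<open>sum_group\<close> consists of the finitely supported functions in \<open>carrier B \<rightarrow>\<^sub>E carrier A\<close>, that is,
  functions with value \<open>undefined\<close> outside \<open>carrier B\<close>.
\<close>

definition wreath_product ::
    "('a, 'c) monoid_scheme \<Rightarrow> ('b, 'd) monoid_scheme \<Rightarrow> (('b \<Rightarrow> 'a) \<times> 'b) monoid" where
  "wreath_product A B =
     (let S = sum_group (carrier B) (\<lambda>_. A) in
      \<lparr>carrier = carrier S \<times> carrier B,
       monoid.mult = (\<lambda>(f, b) (f', b'). (f \<otimes>\<^bsub>S\<^esub> shift B b f', b \<otimes>\<^bsub>B\<^esub> b')),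
       one = (\<one>\<^bsub>S\<^esub>, \<one>\<^bsub>B\<^esub>)\<rparr>)"

end

theory Submission
  imports Defs
begin

text \<open>
  Separation in quotients is handled through homomorphisms: \<open>g\<close> is separated from a
  set \<open>S\<close> as soon as some homomorphism \<open>r\<close> into a group in the class has \<open>r g \<notin> r ` S\<close>
  (\<open>hom_separates\<close>), and finitely many separations can be achieved by one such homomorphism
  (\<open>simultaneous_separation\<close>).

  Write an element of the wreath product \<open>W\<close> as \<open>(f, b)\<close>. Two elements whose top components are not
  conjugate are separated already in \<open>B\<close>, so let the two elements be \<open>(f, b)\<close> and \<open>(g, b)\<close>, not
  conjugate in \<open>W\<close>. Every homomorphism \<open>A \<rightarrow> A'\<close> induces \<open>A wr B \<rightarrow> A' wr B\<close>; if \<open>A\<close> is abelian, every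
  \<open>B \<rightarrow> B'\<close> induces \<open>A wr B \<rightarrow> A wr B'\<close> by multiplying the values over each fibre. Since the class is
  closed under products and extensions, it contains \<open>A' wr B'\<close> whenever it contains \<open>A'\<close> and \<open>B'\<close>.

  If \<open>B\<close> is in the class, it is finite. A conjugator has the form \<open>(h, c)\<close> with \<open>c\<close> in the centraliser
  of \<open>b\<close>, and for fixed \<open>c\<close> a suitable \<open>h\<close> exists iff, at every point, the product of the values of
  \<open>f\<close> shifted by \<open>c\<close> along the cycle of \<open>b\<close> is conjugate in \<open>A\<close> to that of \<open>g\<close>
  (\<open>base_conj_if_cycle_prods_conj\<close>). So non-conjugacy of \<open>(f, b)\<close> and \<open>(g, b)\<close> is witnessed by one
  non-conjugate pair in \<open>A\<close> for each of the finitely many \<open>c\<close>, and a quotient of \<open>A\<close> that keeps all of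
  these pairs non-conjugate separates them (\<open>separable_if_top_in_class\<close>).

  If \<open>A\<close> is abelian, \<open>(f, b)\<close> and \<open>(g, b)\<close> are conjugate iff some \<open>c\<close> in the centraliser of \<open>b\<close> carries
  the totals of \<open>f\<close> over the orbits of \<open>\<langle>b\<rangle>\<close> to those of \<open>g\<close> (\<open>conj_if_totals_agree\<close>). A quotient
  \<open>B \<rightarrow> B'\<close> merges such orbits, and more elements commute with \<open>b\<close> there. Cyclic subgroup separability
  keeps apart the finitely many orbits that matter. A conjugator in the quotient must move some point of
  the support of \<open>f\<close> with non-trivial orbit total into the support of \<open>g\<close>, up to \<open>\<langle>b\<rangle>\<close> and the kernel.
  This leaves finitely many candidates for \<open>c\<close>. Each of them is either prevented from commuting with \<open>b\<close>
  in \<open>B'\<close>, or refuted by a pair of totals that stay different in \<open>A'\<close> (\<open>separated_if_abelian\<close>).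

  Conversely, let \<open>W\<close> be conjugacy separable. If \<open>B\<close> is not in the class, every homomorphism from \<open>W\<close>
  into a group in the class kills some \<open>k \<noteq> \<one>\<close> in \<open>B\<close>. It therefore identifies the copy of \<open>A\<close> at \<open>\<one>\<close>
  with the copy at \<open>k\<close>; these commute, so \<open>A\<close> is abelian (\<open>in_class_or_base_abelian\<close>). If \<open>A\<close> is abelian,
  take \<open>s \<noteq> \<one>\<close> in \<open>A\<close> and \<open>x \<notin> \<langle>b\<rangle>\<close>. The function with value \<open>s\<close> at \<open>\<one>\<close> and inverse value at \<open>x\<close> has a
  non-trivial orbit total, so paired with \<open>b\<close> it is not conjugate to \<open>(\<one>, b)\<close>. A quotient of \<open>W\<close>
  separating these two separates \<open>x\<close> from \<open>\<langle>b\<rangle>\<close> (\<open>cyclic_subgroup_separable_if_separable\<close>).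
\<close>

section \<open>Separation by homomorphisms into the class\<close>

lemma in_class_group: "in_class C G \<Longrightarrow> group G"
  by (simp add: in_class_def)

lemma pseudovariety_product_group:
  fixes I :: "nat set"
  assumes "ext_closed_pseudovariety C" "finite I" "\<And>i. i \<in> I \<Longrightarrow> G i \<in> C"
  shows "in_class C (product_group I G)"
  using assms by (simp add: ext_closed_pseudovariety_def)

lemma pseudovariety_extension:
  fixes G :: "nat monoid"
  assumes "ext_closed_pseudovariety C" "N \<lhd> G" "in_class C (G\<lparr>carrier := N\<rparr>)" "in_class C (G Mod N)"
  shows "in_class C G"
proof -
  have "\<forall>(G :: nat monoid) N. N \<lhd> G \<and> in_class C (G\<lparr>carrier := N\<rparr>) \<and> in_class C (G Mod N) \<longrightarrow> in_class C G"
    using assms(1) unfolding ext_closed_pseudovariety_def by (elim conjE)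
  then show ?thesis using assms(2-4) by blast
qed

lemma in_class_finite:
  assumes "ext_closed_pseudovariety C" "in_class C G"
  shows "finite (carrier G)"
proof -
  obtain H where "H \<in> C" "G \<cong> H"
    using assms(2) by (auto simp: in_class_def)
  then show ?thesis
    using assms(1) iso_finite unfolding ext_closed_pseudovariety_def by metis
qed

text \<open>
  The class is closed under subgroups only through groups on \<open>nat\<close>; this transfers the closure to
  arbitrary element types.
\<close>

lemma in_class_if_embeds:
  assumes C: "ext_closed_pseudovariety C" and Q: "in_class C Q" and G: "group G"
    and h: "h \<in> hom G Q" and inj: "inj_on h (carrier G)"
  shows "in_class C G"
proof -
  obtain H k where H: "H \<in> C" and k: "k \<in> iso Q H"
    using Q by (auto simp: in_class_def is_iso_def)
  have "group Q" "group H"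
    using Q C H by (auto simp: in_class_def ext_closed_pseudovariety_def)
  let ?f = "k \<circ> h"
  have f: "?f \<in> hom G H"
    using h k by (auto simp: iso_def intro: Group.hom_compose)
  interpret group_hom G H ?f
    using G \<open>group H\<close> f by (simp add: group_hom_def group_hom_axioms_def)
  have "in_class C (H\<lparr>carrier := ?f ` carrier G\<rparr>)"
    using C H img_is_subgroup unfolding ext_closed_pseudovariety_def by metis
  then obtain K where K: "K \<in> C" "H\<lparr>carrier := ?f ` carrier G\<rparr> \<cong> K"
    by (auto simp: in_class_def)
  have "inj_on ?f (carrier G)"
    using inj k hom_carrier[OF h] unfolding iso_def bij_betw_def
    by (auto intro!: comp_inj_on elim: inj_on_subset)
  then have "?f \<in> iso G (H\<lparr>carrier := ?f ` carrier G\<rparr>)"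
    using f by (auto simp: iso_def hom_def bij_betw_def)
  then have "G \<cong> K"
    using K(2) iso_trans unfolding is_iso_def by blast
  then show ?thesis
    using G K(1) by (auto simp: in_class_def)
qed

lemma kernel_in_class_normal:
  assumes C: "ext_closed_pseudovariety C" and Q: "in_class C Q" and G: "group G"
    and h: "h \<in> hom G Q"
  shows "kernel G Q h \<in> class_normal C G"
proof -
  interpret group_hom G Q h
    using G h in_class_group[OF Q] by (simp add: group_hom_def group_hom_axioms_def)
  have "in_class C (G Mod kernel G Q h)"
    using in_class_if_embeds[OF C Q _ FactGroup_hom FactGroup_inj_on]
      normal.factorgroup_is_group[OF normal_kernel] by blast
  then show ?thesis
    using normal_kernel by (simp add: class_normal_def)
qed

text \<open>
  Such a \<open>G\<close> is finite, as kernel and image are, so it has an isomorphic copy on \<open>nat\<close>. The extension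
  axiom applies to the copy.
\<close>

lemma in_class_if_extension:
  fixes G :: "('a, 'm) monoid_scheme"
  assumes C: "ext_closed_pseudovariety C" and Q: "in_class C Q" and G: "group G"
    and h: "h \<in> hom G Q" and ker: "in_class C (G\<lparr>carrier := kernel G Q h\<rparr>)"
  shows "in_class C G"
proof -
  interpret group_hom G Q h
    using G h in_class_group[OF Q] by (simp add: group_hom_def group_hom_axioms_def)
  let ?K = "kernel G Q h"
  have "finite ?K"
    using in_class_finite[OF C ker] by simp
  have "finite (h -` {y} \<inter> carrier G)" for y
  proof (cases "h -` {y} \<inter> carrier G = {}")
    case False
    then obtain x where x: "x \<in> carrier G" "h x = y" by blast
    have "h -` {y} \<inter> carrier G \<subseteq> (\<lambda>k. k \<otimes>\<^bsub>G\<^esub> x) ` ?K"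
    proof
      fix z assume z: "z \<in> h -` {y} \<inter> carrier G"
      then have "z \<otimes>\<^bsub>G\<^esub> inv\<^bsub>G\<^esub> x \<in> ?K" "z = z \<otimes>\<^bsub>G\<^esub> inv\<^bsub>G\<^esub> x \<otimes>\<^bsub>G\<^esub> x"
        using x by (auto simp: kernel_def G.m_assoc)
      then show "z \<in> (\<lambda>k. k \<otimes>\<^bsub>G\<^esub> x) ` ?K" by blast
    qed
    with \<open>finite ?K\<close> show ?thesis by (meson finite_imageI finite_subset)
  qed simp
  then have "finite (h -` carrier Q \<inter> carrier G)"
    using in_class_finite[OF C Q] by (simp add: finite_finite_vimage_IntI)
  moreover have "h -` carrier Q \<inter> carrier G = carrier G" by auto
  ultimately have "finite (carrier G)" by simp
  then obtain e :: "'a \<Rightarrow> nat" where e: "inj_on e (carrier G)"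
    using finite_imp_inj_to_nat_seg by blast
  let ?G = "image_group e G"
  define d where "d = inv_into (carrier G) e"
  have e_iso: "e \<in> iso G ?G"
    using e by (auto simp: iso_def hom_def image_group_def bij_betw_def)
  have grp: "group ?G"
    using G.iso_imp_img_group[OF e_iso] by (simp add: image_group_def)
  have d_iso: "d \<in> iso ?G G"
    unfolding d_def by (rule G.iso_set_sym[OF e_iso])
  then have d: "d \<in> hom ?G G" "inj_on d (carrier ?G)"
    by (auto simp: iso_def bij_betw_def)
  have hd: "h \<circ> d \<in> hom ?G Q"
    using d(1) h by (rule Group.hom_compose)
  let ?N = "kernel ?G Q (h \<circ> d)"
  interpret G': group_hom ?G Q "h \<circ> d"
    using grp in_class_group[OF Q] hd by (simp add: group_hom_def group_hom_axioms_def)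
  have "in_class C (?G\<lparr>carrier := ?N\<rparr>)"
  proof (rule in_class_if_embeds[OF C ker])
    show "group (?G\<lparr>carrier := ?N\<rparr>)"
      by (rule subgroup.subgroup_is_group[OF G'.subgroup_kernel grp])
    show "d \<in> hom (?G\<lparr>carrier := ?N\<rparr>) (G\<lparr>carrier := ?K\<rparr>)"
      using d(1) by (auto simp: hom_def kernel_def Pi_iff)
    show "inj_on d (carrier (?G\<lparr>carrier := ?N\<rparr>))"
      using d(2) by (auto simp: kernel_def elim: inj_on_subset)
  qed
  moreover have N: "?N \<lhd> ?G" "in_class C (?G Mod ?N)"
    using kernel_in_class_normal[OF C Q grp hd] by (auto simp: class_normal_def)
  ultimately have "in_class C ?G"
    by (intro pseudovariety_extension[OF C N(1) _ N(2)])
  then show ?thesis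
    using in_class_if_embeds[OF C _ G] e_iso by (auto simp: iso_def bij_betw_def)
qed

text \<open>
  The first projection presents the product as an extension of \<open>P\<close> by a copy of \<open>Q\<close>; this treats
  factors over different element types, which the product axiom does not.
\<close>

lemma in_class_DirProd:
  assumes C: "ext_closed_pseudovariety C" and P: "in_class C P" and Q: "in_class C Q"
  shows "in_class C (P \<times>\<times> Q)"
proof (rule in_class_if_extension[OF C P])
  interpret P: group P using in_class_group[OF P] .
  interpret Q: group Q using in_class_group[OF Q] .
  show grp: "group (P \<times>\<times> Q)"
    by (rule DirProd_group[OF P.group_axioms Q.group_axioms])
  show fst: "fst \<in> hom (P \<times>\<times> Q) P"
    by (auto simp: hom_def DirProd_def)
  let ?K = "kernel (P \<times>\<times> Q) P fst"
  interpret F: group_hom "P \<times>\<times> Q" P fst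
    using grp fst by (simp add: group_hom_def group_hom_axioms_def P.group_axioms)
  show "in_class C ((P \<times>\<times> Q)\<lparr>carrier := ?K\<rparr>)"
  proof (rule in_class_if_embeds[OF C Q])
    show "group ((P \<times>\<times> Q)\<lparr>carrier := ?K\<rparr>)"
      by (rule subgroup.subgroup_is_group[OF F.subgroup_kernel grp])
    show "snd \<in> hom ((P \<times>\<times> Q)\<lparr>carrier := ?K\<rparr>) Q"
      by (auto simp: hom_def DirProd_def kernel_def)
    show "inj_on snd (carrier ((P \<times>\<times> Q)\<lparr>carrier := ?K\<rparr>))"
      by (auto simp: inj_on_def kernel_def)
  qed
qed

lemma in_class_sum_group:
  assumes C: "ext_closed_pseudovariety C" and Q: "in_class C Q" and I: "finite I"
  shows "in_class C (sum_group I (\<lambda>_. Q))"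
proof -
  obtain H k where H: "H \<in> C" and k: "k \<in> iso Q H"
    using Q by (auto simp: in_class_def is_iso_def)
  have [simp]: "group Q" "group H"
    using Q C H by (auto simp: in_class_def ext_closed_pseudovariety_def)
  obtain e where e: "bij_betw e {..<card I} I"
    using ex_bij_betw_nat_finite[OF I] by (auto simp: atLeast0LessThan)
  let ?P = "product_group {..<card I} (\<lambda>_. H)"
  let ?S = "sum_group I (\<lambda>_. Q)"
  have k': "k \<in> hom Q H" "inj_on k (carrier Q)"
    using k by (auto simp: iso_def bij_betw_def)
  have eI: "e i \<in> I" if "i < card I" for i
    using e that by (auto simp: bij_betw_def)
  show ?thesis
  proof (rule in_class_if_embeds[OF C])
    show "in_class C ?P"
      by (rule pseudovariety_product_group[OF C]) (use H in auto)
    show "group ?S" by simp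
    show "(\<lambda>f. \<lambda>i\<in>{..<card I}. k (f (e i))) \<in> hom ?S ?P"
      using k'(1) eI by (auto simp: hom_def carrier_sum_group PiE_iff Pi_iff intro!: restrict_ext)
    show "inj_on (\<lambda>f. \<lambda>i\<in>{..<card I}. k (f (e i))) (carrier ?S)"
    proof (rule inj_onI)
      fix f g assume f: "f \<in> carrier ?S" and g: "g \<in> carrier ?S"
        and eq: "(\<lambda>i\<in>{..<card I}. k (f (e i))) = (\<lambda>i\<in>{..<card I}. k (g (e i)))"
      have "f j = g j" if "j \<in> I" for j
      proof -
        obtain i where i: "i < card I" "e i = j"
          using bij_betw_imp_surj_on[OF e] \<open>j \<in> I\<close> by (metis imageE lessThan_iff)
        then have "k (f j) = k (g j)" using fun_cong[OF eq, of i] by simp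
        then show ?thesis
          using k'(2) f g \<open>j \<in> I\<close> by (auto simp: carrier_sum_group PiE_iff inj_on_def)
      qed
      with f g show "f = g"
        by (intro extensionalityI[of _ I]) (auto simp: carrier_sum_group PiE_iff)
    qed
  qed
qed

text \<open>
  \<open>M \<inter> N\<close> is the kernel of the diagonal map into the product of the two quotients.
\<close>

lemma class_normal_Int:
  assumes C: "ext_closed_pseudovariety C" and G: "group G"
    and M: "M \<in> class_normal C G" and N: "N \<in> class_normal C G"
  shows "M \<inter> N \<in> class_normal C G"
proof -
  have MN: "M \<lhd> G" "N \<lhd> G" "in_class C (G Mod M)" "in_class C (G Mod N)"
    using M N by (auto simp: class_normal_def)
  interpret M: normal M G by fact
  interpret N: normal N G by fact
  let ?P = "(G Mod M) \<times>\<times> (G Mod N)" and ?h = "\<lambda>g. (M #>\<^bsub>G\<^esub> g, N #>\<^bsub>G\<^esub> g)"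
  have "?h \<in> hom G ?P"
    using M.r_coset_hom_Mod N.r_coset_hom_Mod by (auto simp: hom_def DirProd_def Pi_iff)
  then have "kernel G ?P ?h \<in> class_normal C G"
    by (rule kernel_in_class_normal[OF C in_class_DirProd[OF C MN(3,4)] G])
  moreover have "kernel G ?P ?h = M \<inter> N"
  proof -
    have "M #>\<^bsub>G\<^esub> x = M \<longleftrightarrow> x \<in> M" "N #>\<^bsub>G\<^esub> x = N \<longleftrightarrow> x \<in> N" if "x \<in> carrier G" for x
      using M.coset_join1[OF _ that M.is_subgroup] M.coset_join2[OF that M.is_subgroup]
        M.coset_join1[OF _ that N.is_subgroup] M.coset_join2[OF that N.is_subgroup]
      by (iprover)+
    then show ?thesis
      using M.subset N.subset by (auto simp: kernel_def DirProd_def FactGroup_def)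
  qed
  ultimately show ?thesis by simp
qed

lemma carrier_in_class_normal:
  assumes C: "ext_closed_pseudovariety C" and G: "group G"
  shows "carrier G \<in> class_normal C G"
proof -
  \<comment> \<open>the empty product is the trivial group in the class\<close>
  let ?P = "product_group ({} :: nat set) (\<lambda>_. undefined :: nat monoid)" and ?h = "\<lambda>_ _. undefined"
  have "in_class C ?P"
    by (rule pseudovariety_product_group[OF C]) auto
  then have "kernel G ?P ?h \<in> class_normal C G"
    by (rule kernel_in_class_normal[OF C _ G]) (auto simp: hom_def fun_eq_iff)
  then show ?thesis
    by (simp add: kernel_def restrict_def)
qed

text \<open>
  Intersecting the finitely many separating normal subgroups keeps every separation, because a smaller
  normal subgroup identifies fewer elements. Surjectivity of \<open>p\<close> is recorded so that properties such as
  commutativity pass to \<open>Q\<close>.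
\<close>

lemma simultaneous_separation:
  fixes G :: "('a, 'm) monoid_scheme"
  assumes C: "ext_closed_pseudovariety C" and G: "group G" and I: "finite I"
    and sep: "\<And>g S. (g, S) \<in> I \<Longrightarrow> class_separable C G S \<and> g \<in> carrier G - S"
  obtains Q :: "'a set monoid" and p
  where "in_class C Q" "p \<in> hom G Q" "p ` carrier G = carrier Q"
    "\<And>g S. (g, S) \<in> I \<Longrightarrow> p g \<notin> p ` S"
proof -
  interpret G: group G by fact
  have "\<exists>N \<in> class_normal C G. \<forall>(g, S) \<in> I. N #>\<^bsub>G\<^esub> g \<notin> (\<lambda>x. N #>\<^bsub>G\<^esub> x) ` S"
    using I sep
  proof (induction I rule: finite_induct)
    case empty
    then show ?case using carrier_in_class_normal[OF C G] by blast
  next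
    case (insert i I)
    obtain g S where i: "i = (g, S)" by (cases i)
    obtain M where M: "M \<in> class_normal C G" "\<forall>(g, S) \<in> I. M #>\<^bsub>G\<^esub> g \<notin> (\<lambda>x. M #>\<^bsub>G\<^esub> x) ` S"
      using insert.IH insert.prems by (meson insertCI)
    obtain N where N: "N \<in> class_normal C G" "N #>\<^bsub>G\<^esub> g \<notin> (\<lambda>x. N #>\<^bsub>G\<^esub> x) ` S"
      using insert.prems[of g S] i unfolding class_separable_def by blast
    have sub: "subgroup M G" "subgroup N G"
      using M N by (auto simp: class_normal_def normal_def)
    have coarser: "K #>\<^bsub>G\<^esub> t \<notin> (\<lambda>x. K #>\<^bsub>G\<^esub> x) ` T \<Longrightarrow> (M \<inter> N) #>\<^bsub>G\<^esub> t \<notin> (\<lambda>x. (M \<inter> N) #>\<^bsub>G\<^esub> x) ` T"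
      if "(t, T) \<in> insert i I" "K = M \<or> K = N" for t T K
    proof (rule notI, erule imageE)
      assume neq: "K #>\<^bsub>G\<^esub> t \<notin> (\<lambda>x. K #>\<^bsub>G\<^esub> x) ` T"
      fix x assume eq: "(M \<inter> N) #>\<^bsub>G\<^esub> t = (M \<inter> N) #>\<^bsub>G\<^esub> x" and x: "x \<in> T"
      have t: "t \<in> carrier G" "x \<in> carrier G"
        using insert.prems[OF that(1)] x by (auto simp: class_separable_def)
      have "t \<in> (M \<inter> N) #>\<^bsub>G\<^esub> x"
        using G.rcos_self[OF t(1) G.subgroups_Inter_pair[OF sub]] eq by simp
      then have "t \<in> K #>\<^bsub>G\<^esub> x"
        using that(2) by (auto simp: r_coset_def)
      then have "K #>\<^bsub>G\<^esub> x = K #>\<^bsub>G\<^esub> t"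
        using G.repr_independence[OF _ t(2), of t K] sub that(2) by blast
      with neq x show False by auto
    qed
    have "\<forall>(g, S) \<in> insert i I. (M \<inter> N) #>\<^bsub>G\<^esub> g \<notin> (\<lambda>x. (M \<inter> N) #>\<^bsub>G\<^esub> x) ` S"
    proof (rule ballI)
      fix p assume p: "p \<in> insert i I"
      obtain t T where tT: "p = (t, T)" by (cases p)
      have "(M \<inter> N) #>\<^bsub>G\<^esub> t \<notin> (\<lambda>x. (M \<inter> N) #>\<^bsub>G\<^esub> x) ` T"
      proof (cases "p = i")
        case True
        then show ?thesis using coarser[of t T N] N(2) i tT p by simp
      next
        case False
        then have "M #>\<^bsub>G\<^esub> t \<notin> (\<lambda>x. M #>\<^bsub>G\<^esub> x) ` T"
          using M(2) p tT by blast
        then show ?thesis using coarser[of t T M] tT p by blast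
      qed
      then show "case p of (g, S) \<Rightarrow> (M \<inter> N) #>\<^bsub>G\<^esub> g \<notin> (\<lambda>x. (M \<inter> N) #>\<^bsub>G\<^esub> x) ` S"
        using tT by simp
    qed
    then show ?case
      using class_normal_Int[OF C G M(1) N(1)] by blast
  qed
  then obtain N where N: "N \<lhd> G" "in_class C (G Mod N)"
    "\<forall>(g, S) \<in> I. N #>\<^bsub>G\<^esub> g \<notin> (\<lambda>x. N #>\<^bsub>G\<^esub> x) ` S"
    by (auto simp: class_normal_def)
  show ?thesis
  proof (rule that)
    show "in_class C (G Mod N)" by fact
    show "(\<lambda>x. N #>\<^bsub>G\<^esub> x) \<in> hom G (G Mod N)"
      by (rule normal.r_coset_hom_Mod[OF N(1)])
    show "(\<lambda>x. N #>\<^bsub>G\<^esub> x) ` carrier G = carrier (G Mod N)"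
      by (auto simp: FactGroup_def RCOSETS_def)
  qed (use N(3) in blast)
qed

text \<open>
  The kernel of \<open>p\<close> is the separating normal subgroup.
\<close>

lemma hom_separates:
  assumes C: "ext_closed_pseudovariety C" and G: "group G" and S: "S \<subseteq> carrier G"
    and Q: "in_class C Q" and p: "p \<in> hom G Q" and g: "g \<in> carrier G" "p g \<notin> p ` S"
  shows "\<exists>N \<in> class_normal C G. N #>\<^bsub>G\<^esub> g \<notin> (\<lambda>x. N #>\<^bsub>G\<^esub> x) ` S"
proof -
  interpret group_hom G Q p
    using G p in_class_group[OF Q] by (simp add: group_hom_def group_hom_axioms_def)
  let ?K = "kernel G Q p"
  have "p x = p y" if "?K #>\<^bsub>G\<^esub> x = ?K #>\<^bsub>G\<^esub> y" "x \<in> carrier G" "y \<in> carrier G" for x y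
  proof -
    have "x \<in> ?K #>\<^bsub>G\<^esub> y"
      using that G.rcos_self[OF _ subgroup_kernel] by metis
    then show ?thesis using that by (auto simp: r_coset_def kernel_def)
  qed
  then have "?K #>\<^bsub>G\<^esub> g \<notin> (\<lambda>x. ?K #>\<^bsub>G\<^esub> x) ` S"
    using g S by blast
  then show ?thesis
    using kernel_in_class_normal[OF C Q G p] by blast
qed

lemma conj_class_one:
  assumes "group G"
  shows "conj_class G \<one>\<^bsub>G\<^esub> = {\<one>\<^bsub>G\<^esub>}"
proof -
  interpret group G by fact
  have "conj_class G \<one>\<^bsub>G\<^esub> = (\<lambda>_. \<one>\<^bsub>G\<^esub>) ` carrier G"
    unfolding conj_class_def by (intro image_cong) auto
  then show ?thesis by auto
qed

lemma mem_conj_class_iff: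
  assumes "group G" "g \<in> carrier G" "g' \<in> carrier G"
  shows "g' \<in> conj_class G g \<longleftrightarrow> (\<exists>k \<in> carrier G. k \<otimes>\<^bsub>G\<^esub> g = g' \<otimes>\<^bsub>G\<^esub> k)"
proof -
  interpret group G by fact
  have "g' = k \<otimes>\<^bsub>G\<^esub> g \<otimes>\<^bsub>G\<^esub> inv\<^bsub>G\<^esub> k \<longleftrightarrow> k \<otimes>\<^bsub>G\<^esub> g = g' \<otimes>\<^bsub>G\<^esub> k" if "k \<in> carrier G" for k
    using that assms(2,3) inv_solve_right[of g' "k \<otimes>\<^bsub>G\<^esub> g" k] by auto
  then show ?thesis
    unfolding conj_class_def image_iff by blast
qed

lemma conj_class_conj:
  assumes "group G" "g \<in> carrier G" "k \<in> carrier G"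
  shows "conj_class G (k \<otimes>\<^bsub>G\<^esub> g \<otimes>\<^bsub>G\<^esub> inv\<^bsub>G\<^esub> k) = conj_class G g"
proof -
  interpret group G by fact
  have "conj_class G (k \<otimes>\<^bsub>G\<^esub> g \<otimes>\<^bsub>G\<^esub> inv\<^bsub>G\<^esub> k) = (\<lambda>h. h \<otimes>\<^bsub>G\<^esub> g \<otimes>\<^bsub>G\<^esub> inv\<^bsub>G\<^esub> h) ` (\<lambda>h. h \<otimes>\<^bsub>G\<^esub> k) ` carrier G"
    unfolding conj_class_def image_image
    by (intro image_cong) (use assms in \<open>auto simp: inv_mult_group m_assoc\<close>)
  moreover have "(\<lambda>h. h \<otimes>\<^bsub>G\<^esub> k) ` carrier G = carrier G"
  proof
    have "h = h \<otimes>\<^bsub>G\<^esub> inv\<^bsub>G\<^esub> k \<otimes>\<^bsub>G\<^esub> k" if "h \<in> carrier G" for h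
      using that assms(3) by (simp add: m_assoc)
    then show "carrier G \<subseteq> (\<lambda>h. h \<otimes>\<^bsub>G\<^esub> k) ` carrier G"
      using assms(3) by (metis (no_types, lifting) image_eqI inv_closed m_closed subsetI)
  qed (use assms(3) in auto)
  ultimately show ?thesis
    by (simp add: conj_class_def)
qed

lemma conj_class_subset: "group G \<Longrightarrow> g \<in> carrier G \<Longrightarrow> conj_class G g \<subseteq> carrier G"
  by (auto simp: conj_class_def group.is_monoid intro!: monoid.m_closed group.inv_closed)

section \<open>The wreath product as a group\<close>

locale wreath = A: group A + B: group B
  for A :: "('a, 'c) monoid_scheme" and B :: "('b, 'd) monoid_scheme"
begin

abbreviation base where "base \<equiv> sum_group (carrier B) (\<lambda>_. A)"
abbreviation W where "W \<equiv> wreath_product A B"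

sublocale base: group base
  by simp

lemma base_iff:
  "f \<in> carrier base \<longleftrightarrow> f \<in> carrier B \<rightarrow>\<^sub>E carrier A \<and> finite {x \<in> carrier B. f x \<noteq> \<one>\<^bsub>A\<^esub>}"
  by (simp add: carrier_sum_group)

lemma base_closed: "f \<in> carrier base \<Longrightarrow> x \<in> carrier B \<Longrightarrow> f x \<in> carrier A"
  by (auto simp: base_iff)

lemma base_finite: "f \<in> carrier base \<Longrightarrow> finite {x \<in> carrier B. f x \<noteq> \<one>\<^bsub>A\<^esub>}"
  by (auto simp: base_iff)

lemma base_eqI:
  assumes "f \<in> carrier base" "g \<in> carrier base" "\<And>x. x \<in> carrier B \<Longrightarrow> f x = g x"
  shows "f = g"
  using assms by (intro extensionalityI[of _ "carrier B"]) (auto simp: base_iff PiE_iff)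

lemma mult_base: "x \<in> carrier B \<Longrightarrow> (f \<otimes>\<^bsub>base\<^esub> g) x = f x \<otimes>\<^bsub>A\<^esub> g x"
  by simp

lemma one_base: "x \<in> carrier B \<Longrightarrow> \<one>\<^bsub>base\<^esub> x = \<one>\<^bsub>A\<^esub>"
  by simp

lemma inv_base: "f \<in> carrier base \<Longrightarrow> x \<in> carrier B \<Longrightarrow> (inv\<^bsub>base\<^esub> f) x = inv\<^bsub>A\<^esub> (f x)"
  by simp

lemma shift_apply: "x \<in> carrier B \<Longrightarrow> shift B b f x = f (inv\<^bsub>B\<^esub> b \<otimes>\<^bsub>B\<^esub> x)"
  by (simp add: shift_def)

lemma shift_closed:
  assumes f: "f \<in> carrier base" and b: "b \<in> carrier B"
  shows "shift B b f \<in> carrier base"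
proof -
  have "{x \<in> carrier B. shift B b f x \<noteq> \<one>\<^bsub>A\<^esub>} \<subseteq> (\<lambda>x. b \<otimes>\<^bsub>B\<^esub> x) ` {x \<in> carrier B. f x \<noteq> \<one>\<^bsub>A\<^esub>}"
  proof
    fix x assume "x \<in> {x \<in> carrier B. shift B b f x \<noteq> \<one>\<^bsub>A\<^esub>}"
    then have "inv\<^bsub>B\<^esub> b \<otimes>\<^bsub>B\<^esub> x \<in> {x \<in> carrier B. f x \<noteq> \<one>\<^bsub>A\<^esub>}" "x = b \<otimes>\<^bsub>B\<^esub> (inv\<^bsub>B\<^esub> b \<otimes>\<^bsub>B\<^esub> x)"
      using b by (auto simp: shift_apply simp flip: B.m_assoc)
    then show "x \<in> (\<lambda>x. b \<otimes>\<^bsub>B\<^esub> x) ` {x \<in> carrier B. f x \<noteq> \<one>\<^bsub>A\<^esub>}" by blast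
  qed
  then have "finite {x \<in> carrier B. shift B b f x \<noteq> \<one>\<^bsub>A\<^esub>}"
    using base_finite[OF f] by (meson finite_imageI finite_subset)
  then show ?thesis
    using f b by (auto simp: base_iff shift_def PiE_iff)
qed

lemma shift_mult:
  assumes "f \<in> carrier base" "g \<in> carrier base" "b \<in> carrier B"
  shows "shift B b (f \<otimes>\<^bsub>base\<^esub> g) = shift B b f \<otimes>\<^bsub>base\<^esub> shift B b g"
  using assms by (auto simp: shift_def fun_eq_iff)

lemma shift_shift:
  assumes "b \<in> carrier B" "c \<in> carrier B"
  shows "shift B b (shift B c f) = shift B (b \<otimes>\<^bsub>B\<^esub> c) f"
  using assms by (auto simp: shift_def fun_eq_iff B.inv_mult_group B.m_assoc)

lemma shift_one: "f \<in> carrier base \<Longrightarrow> shift B \<one>\<^bsub>B\<^esub> f = f"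
  by (auto simp: shift_def fun_eq_iff base_iff PiE_iff extensional_def)

lemma shift_base_one: "b \<in> carrier B \<Longrightarrow> shift B b \<one>\<^bsub>base\<^esub> = \<one>\<^bsub>base\<^esub>"
  by (auto simp: shift_def fun_eq_iff)

lemma shift_group_hom: "b \<in> carrier B \<Longrightarrow> group_hom base base (shift B b)"
  using base.group_axioms shift_closed shift_mult
  by (auto simp: group_hom_def group_hom_axioms_def hom_def simp del: mult_sum_group)

lemma shift_inv:
  assumes "f \<in> carrier base" "b \<in> carrier B"
  shows "shift B b (inv\<^bsub>base\<^esub> f) = inv\<^bsub>base\<^esub> (shift B b f)"
  using group_hom.hom_inv[OF shift_group_hom[OF assms(2)] assms(1)] .

lemma carrier_W: "carrier W = carrier base \<times> carrier B"
  by (simp add: wreath_product_def Let_def)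

lemma one_W: "\<one>\<^bsub>W\<^esub> = (\<one>\<^bsub>base\<^esub>, \<one>\<^bsub>B\<^esub>)"
  by (simp add: wreath_product_def Let_def)

lemma mult_W: "(f, b) \<otimes>\<^bsub>W\<^esub> (g, c) = (f \<otimes>\<^bsub>base\<^esub> shift B b g, b \<otimes>\<^bsub>B\<^esub> c)"
  by (simp add: wreath_product_def Let_def)

lemma group_W: "group W"
proof (rule groupI)
  fix p q assume "p \<in> carrier W" "q \<in> carrier W"
  then show "p \<otimes>\<^bsub>W\<^esub> q \<in> carrier W"
    by (cases p; cases q) (simp add: carrier_W mult_W shift_closed del: mult_sum_group)
next
  show "\<one>\<^bsub>W\<^esub> \<in> carrier W"
    by (simp add: carrier_W one_W del: one_sum_group)
next
  fix p q r assume "p \<in> carrier W" "q \<in> carrier W" "r \<in> carrier W"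
  then show "p \<otimes>\<^bsub>W\<^esub> q \<otimes>\<^bsub>W\<^esub> r = p \<otimes>\<^bsub>W\<^esub> (q \<otimes>\<^bsub>W\<^esub> r)"
    by (cases p; cases q; cases r)
      (simp add: carrier_W mult_W shift_closed shift_mult shift_shift base.m_assoc B.m_assoc
        del: mult_sum_group)
next
  fix p assume "p \<in> carrier W"
  then show "\<one>\<^bsub>W\<^esub> \<otimes>\<^bsub>W\<^esub> p = p"
    by (cases p) (simp add: carrier_W one_W mult_W shift_one del: mult_sum_group one_sum_group)
next
  fix p assume "p \<in> carrier W"
  then obtain f b where p: "p = (f, b)" "f \<in> carrier base" "b \<in> carrier B"
    by (cases p) (auto simp: carrier_W)
  then have "(shift B (inv\<^bsub>B\<^esub> b) (inv\<^bsub>base\<^esub> f), inv\<^bsub>B\<^esub> b) \<otimes>\<^bsub>W\<^esub> p = \<one>\<^bsub>W\<^esub>"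
    by (simp add: mult_W one_W shift_closed shift_inv del: mult_sum_group one_sum_group inv_sum_group)
  moreover have "(shift B (inv\<^bsub>B\<^esub> b) (inv\<^bsub>base\<^esub> f), inv\<^bsub>B\<^esub> b) \<in> carrier W"
    using p by (simp add: carrier_W shift_closed del: inv_sum_group)
  ultimately show "\<exists>q\<in>carrier W. q \<otimes>\<^bsub>W\<^esub> p = \<one>\<^bsub>W\<^esub>" by blast
qed

text \<open>
  The base component of a conjugate is a product of \<open>h\<close>, a shifted \<open>f\<close> and the inverse of a shifted
  \<open>h\<close>; the necessary conditions for conjugacy below are read off from it.
\<close>

lemma conj_W:
  assumes "f \<in> carrier base" "b \<in> carrier B" "h \<in> carrier base" "c \<in> carrier B"
  shows "(h, c) \<otimes>\<^bsub>W\<^esub> (f, b) \<otimes>\<^bsub>W\<^esub> inv\<^bsub>W\<^esub> (h, c) =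
    (h \<otimes>\<^bsub>base\<^esub> shift B c f \<otimes>\<^bsub>base\<^esub> inv\<^bsub>base\<^esub> (shift B (c \<otimes>\<^bsub>B\<^esub> b \<otimes>\<^bsub>B\<^esub> inv\<^bsub>B\<^esub> c) h),
     c \<otimes>\<^bsub>B\<^esub> b \<otimes>\<^bsub>B\<^esub> inv\<^bsub>B\<^esub> c)" (is "?l = ?r")
proof -
  interpret W: group W by (rule group_W)
  have "?r \<otimes>\<^bsub>W\<^esub> (h, c) = (h, c) \<otimes>\<^bsub>W\<^esub> (f, b)"
    using assms by (simp add: mult_W base.m_assoc B.m_assoc shift_closed
        del: mult_sum_group one_sum_group inv_sum_group)
  moreover have "?r \<in> carrier W" "(h, c) \<in> carrier W" "(f, b) \<in> carrier W"
    using assms by (auto simp: carrier_W shift_closed simp del: mult_sum_group inv_sum_group)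
  ultimately show ?thesis
    using W.inv_solve_right'[of ?r "(h, c) \<otimes>\<^bsub>W\<^esub> (f, b)" "(h, c)"] W.inv_solve_right by (metis W.m_closed)
qed

lemma snd_hom_W: "snd \<in> hom W B"
  by (auto simp: hom_def carrier_W mult_W)

lemma embed_hom_W: "(\<lambda>b. (\<one>\<^bsub>base\<^esub>, b)) \<in> hom B W"
  by (auto simp: hom_def carrier_W mult_W shift_base_one simp del: one_sum_group mult_sum_group)

text \<open>
  The projection to \<open>B\<close> has the base group as its kernel, a finite power of \<open>A\<close>.
\<close>

lemma in_class_W:
  assumes C: "ext_closed_pseudovariety C" and "in_class C A" "in_class C B"
  shows "in_class C W"
proof (rule in_class_if_extension[OF C \<open>in_class C B\<close> group_W snd_hom_W])
  let ?K = "kernel W B snd"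
  interpret F: group_hom W B snd
    using group_W snd_hom_W by (simp add: group_hom_def group_hom_axioms_def B.group_axioms)
  show "in_class C (W\<lparr>carrier := ?K\<rparr>)"
  proof (rule in_class_if_embeds[OF C in_class_sum_group[OF C \<open>in_class C A\<close>
          in_class_finite[OF C \<open>in_class C B\<close>]]])
    show "group (W\<lparr>carrier := ?K\<rparr>)"
      by (rule subgroup.subgroup_is_group[OF F.subgroup_kernel group_W])
    show "fst \<in> hom (W\<lparr>carrier := ?K\<rparr>) base"
      by (auto simp: hom_def kernel_def carrier_W mult_W shift_one simp del: mult_sum_group)
    show "inj_on fst (carrier (W\<lparr>carrier := ?K\<rparr>))"
      by (auto simp: inj_on_def kernel_def)
  qed
qed

definition map_base :: "('a \<Rightarrow> 'e) \<Rightarrow> ('b \<Rightarrow> 'a) \<Rightarrow> 'b \<Rightarrow> 'e" where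
  "map_base p f = (\<lambda>x\<in>carrier B. p (f x))"

lemma map_base_closed:
  assumes "wreath A' B" and p: "p \<in> hom A A'" and f: "f \<in> carrier base"
  shows "map_base p f \<in> carrier (sum_group (carrier B) (\<lambda>_. A'))"
proof -
  interpret W': wreath A' B by fact
  have "p \<one>\<^bsub>A\<^esub> = \<one>\<^bsub>A'\<^esub>"
    using hom_one[OF p A.group_axioms W'.A.group_axioms] .
  then have "{x \<in> carrier B. p (f x) \<noteq> \<one>\<^bsub>A'\<^esub>} \<subseteq> {x \<in> carrier B. f x \<noteq> \<one>\<^bsub>A\<^esub>}"
    by auto
  then have "finite {x \<in> carrier B. p (f x) \<noteq> \<one>\<^bsub>A'\<^esub>}"
    using base_finite[OF f] finite_subset by blast
  then show ?thesis
    using base_closed[OF f] hom_carrier[OF p]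
    by (auto simp: W'.base_iff map_base_def cong: conj_cong)
qed

lemma map_base_hom:
  assumes "wreath A' B" and p: "p \<in> hom A A'"
  shows "(\<lambda>(f, b). (map_base p f, b)) \<in> hom W (wreath_product A' B)"
proof -
  interpret W': wreath A' B by fact
  have "map_base p (f \<otimes>\<^bsub>base\<^esub> shift B b g) = map_base p f \<otimes>\<^bsub>W'.base\<^esub> shift B b (map_base p g)"
    if "f \<in> carrier base" "g \<in> carrier base" "b \<in> carrier B" for f g b
    using that hom_mult[OF p] by (auto simp: map_base_def shift_def fun_eq_iff base_closed)
  then show ?thesis
    using map_base_closed[OF assms]
    by (auto simp: hom_def carrier_W W'.carrier_W mult_W W'.mult_W
        simp del: mult_sum_group)
qed

text \<open>
  If the top components are conjugate by \<open>c\<close>, conjugating the first element by \<open>c\<close> makes them equal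
  without changing its conjugacy class; otherwise a quotient of \<open>B\<close> separates.
\<close>

lemma conjugacy_separable_W:
  assumes C: "ext_closed_pseudovariety C" and B: "conjugacy_separable C B"
    and sep: "\<And>f g b. f \<in> carrier base \<Longrightarrow> g \<in> carrier base \<Longrightarrow> b \<in> carrier B \<Longrightarrow>
      (g, b) \<notin> conj_class W (f, b) \<Longrightarrow>
      \<exists>N \<in> class_normal C W. N #>\<^bsub>W\<^esub> (g, b) \<notin> (\<lambda>x. N #>\<^bsub>W\<^esub> x) ` conj_class W (f, b)"
  shows "conjugacy_separable C W"
  unfolding conjugacy_separable_def class_separable_def
proof (intro ballI conjI)
  fix p assume p: "p \<in> carrier W"
  show cl: "conj_class W p \<subseteq> carrier W"
    by (rule conj_class_subset[OF group_W p])
  fix q assume q: "q \<in> carrier W - conj_class W p"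
  obtain f b where fb: "p = (f, b)" "f \<in> carrier base" "b \<in> carrier B"
    using p by (cases p) (auto simp: carrier_W)
  obtain g d where gd: "q = (g, d)" "g \<in> carrier base" "d \<in> carrier B"
    using q by (cases q) (auto simp: carrier_W)
  show "\<exists>N\<in>class_normal C W. N #>\<^bsub>W\<^esub> q \<notin> (\<lambda>x. N #>\<^bsub>W\<^esub> x) ` conj_class W p"
  proof (cases "d \<in> conj_class B b")
    case True
    then obtain c where c: "c \<in> carrier B" "d = c \<otimes>\<^bsub>B\<^esub> b \<otimes>\<^bsub>B\<^esub> inv\<^bsub>B\<^esub> c"
      by (auto simp: conj_class_def)
    have "(\<one>\<^bsub>base\<^esub>, c) \<otimes>\<^bsub>W\<^esub> p \<otimes>\<^bsub>W\<^esub> inv\<^bsub>W\<^esub> (\<one>\<^bsub>base\<^esub>, c) = (shift B c f, d)"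
      using fb c gd(3) by (simp add: conj_W shift_closed shift_base_one del: one_sum_group mult_sum_group inv_sum_group)
    then have "conj_class W p = conj_class W (shift B c f, d)"
      using conj_class_conj[OF group_W p, of "(\<one>\<^bsub>base\<^esub>, c)"] c(1)
      by (simp add: carrier_W del: one_sum_group)
    then show ?thesis
      using sep[of "shift B c f" g d] fb gd q shift_closed[OF fb(2) c(1)] by auto
  next
    case False
    have "class_separable C B (conj_class B b)"
      using B fb(3) by (simp add: conjugacy_separable_def)
    then obtain Q :: "'b set monoid" and r where Q: "in_class C Q" "r \<in> hom B Q" "r d \<notin> r ` conj_class B b"
      using simultaneous_separation[OF C B.group_axioms, of "{(d, conj_class B b)}"] False gd(3)
      by (metis DiffI finite.emptyI finite.insertI insertI1 prod.inject singletonD)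
    show ?thesis
    proof (rule hom_separates[OF C group_W cl Q(1) Group.hom_compose[OF snd_hom_W Q(2)]])
      show "q \<in> carrier W" using q by simp
      have "snd k \<in> conj_class B b" if "k \<in> conj_class W p" for k
        using that fb by (auto simp: conj_class_def carrier_W conj_W simp del: mult_sum_group inv_sum_group)
      then show "(r \<circ> snd) q \<notin> (r \<circ> snd) ` conj_class W p"
        using Q(3) gd(1) by auto
    qed
  qed
qed

definition single :: "'b \<Rightarrow> 'a \<Rightarrow> 'b \<Rightarrow> 'a" where
  "single x s = (\<lambda>y\<in>carrier B. if y = x then s else \<one>\<^bsub>A\<^esub>)"

lemma single_closed: "s \<in> carrier A \<Longrightarrow> single x s \<in> carrier base"
  by (auto simp: base_iff single_def intro: finite_subset[of _ "{x}"])

lemma shift_single: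
  assumes "c \<in> carrier B" "x \<in> carrier B"
  shows "shift B c (single x s) = single (c \<otimes>\<^bsub>B\<^esub> x) s"
proof -
  have "inv\<^bsub>B\<^esub> c \<otimes>\<^bsub>B\<^esub> y = x \<longleftrightarrow> y = c \<otimes>\<^bsub>B\<^esub> x" if "y \<in> carrier B" for y
    using assms that by (metis B.inv_closed B.l_inv B.r_inv B.l_one B.m_assoc)
  then show ?thesis
    using assms by (auto simp: shift_def single_def fun_eq_iff)
qed

end

section \<open>Wreath products whose top group is in the class\<close>

context wreath
begin

text \<open>
  \<open>cycle_prod a f x n\<close> is the product of the values of \<open>f\<close> at \<open>x, a x, ..., a\<^sup>n\<^sup>-\<^sup>1 x\<close>. For
  \<open>a = inv b\<close> it is the value at \<open>x\<close> of the base component of the \<open>n\<close>-th power of \<open>(f, b)\<close>.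
\<close>

primrec cycle_prod :: "'b \<Rightarrow> ('b \<Rightarrow> 'a) \<Rightarrow> 'b \<Rightarrow> nat \<Rightarrow> 'a" where
  "cycle_prod a f x 0 = \<one>\<^bsub>A\<^esub>"
| "cycle_prod a f x (Suc n) = cycle_prod a f x n \<otimes>\<^bsub>A\<^esub> f (a [^]\<^bsub>B\<^esub> n \<otimes>\<^bsub>B\<^esub> x)"

lemma cycle_prod_closed:
  "f \<in> carrier base \<Longrightarrow> a \<in> carrier B \<Longrightarrow> x \<in> carrier B \<Longrightarrow> cycle_prod a f x n \<in> carrier A"
  by (induction n) (auto intro: base_closed)

lemma cycle_prod_add:
  assumes "f \<in> carrier base" "a \<in> carrier B" "x \<in> carrier B"
  shows "cycle_prod a f x (m + n) = cycle_prod a f x m \<otimes>\<^bsub>A\<^esub> cycle_prod a f (a [^]\<^bsub>B\<^esub> m \<otimes>\<^bsub>B\<^esub> x) n"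
proof (induction n)
  case 0
  then show ?case using assms by (simp add: cycle_prod_closed)
next
  case (Suc n)
  have "a [^]\<^bsub>B\<^esub> (m + n) = a [^]\<^bsub>B\<^esub> n \<otimes>\<^bsub>B\<^esub> a [^]\<^bsub>B\<^esub> m"
    using assms by (simp add: B.nat_pow_mult add.commute)
  then show ?case
    using Suc assms by (simp add: cycle_prod_closed base_closed A.m_assoc B.m_assoc)
qed

text \<open>
  Telescoping: \<open>rel\<close> says that \<open>h\<close> conjugates \<open>f\<close> to \<open>g\<close> one step at a time. When \<open>n\<close> is a
  multiple of the order of \<open>a\<close>, the two cycle products are conjugate by \<open>h x\<close>.
\<close>

lemma cycle_prod_conj:
  assumes "f \<in> carrier base" "g \<in> carrier base" "h \<in> carrier base" "a \<in> carrier B" "x \<in> carrier B"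
    and rel: "\<And>y. y \<in> carrier B \<Longrightarrow> g y \<otimes>\<^bsub>A\<^esub> h (a \<otimes>\<^bsub>B\<^esub> y) = h y \<otimes>\<^bsub>A\<^esub> f y"
  shows "cycle_prod a g x n \<otimes>\<^bsub>A\<^esub> h (a [^]\<^bsub>B\<^esub> n \<otimes>\<^bsub>B\<^esub> x) = h x \<otimes>\<^bsub>A\<^esub> cycle_prod a f x n"
proof (induction n)
  case 0
  then show ?case using assms by (simp add: base_closed)
next
  case (Suc n)
  let ?y = "a [^]\<^bsub>B\<^esub> n \<otimes>\<^bsub>B\<^esub> x"
  have y: "?y \<in> carrier B" "a [^]\<^bsub>B\<^esub> Suc n \<otimes>\<^bsub>B\<^esub> x = a \<otimes>\<^bsub>B\<^esub> ?y"
    using assms B.nat_pow_Suc2[of a n] by (auto simp: B.m_assoc simp del: B.nat_pow_Suc)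
  have "cycle_prod a g x (Suc n) \<otimes>\<^bsub>A\<^esub> h (a [^]\<^bsub>B\<^esub> Suc n \<otimes>\<^bsub>B\<^esub> x)
      = cycle_prod a g x n \<otimes>\<^bsub>A\<^esub> (g ?y \<otimes>\<^bsub>A\<^esub> h (a \<otimes>\<^bsub>B\<^esub> ?y))"
    unfolding y(2) using assms y(1) by (simp add: cycle_prod_closed base_closed A.m_assoc)
  also have "\<dots> = (cycle_prod a g x n \<otimes>\<^bsub>A\<^esub> h ?y) \<otimes>\<^bsub>A\<^esub> f ?y"
    unfolding rel[OF y(1)] using assms y(1) by (simp add: cycle_prod_closed base_closed A.m_assoc)
  also have "\<dots> = h x \<otimes>\<^bsub>A\<^esub> cycle_prod a f x (Suc n)"
    unfolding Suc using assms y(1) by (simp add: cycle_prod_closed base_closed A.m_assoc)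
  finally show ?case .
qed

lemma hom_cycle_prod_cong:
  assumes "f \<in> carrier base" "g \<in> carrier base" "a \<in> carrier B" "x \<in> carrier B"
    and p: "p \<in> hom A A'" and eq: "\<And>y. y \<in> carrier B \<Longrightarrow> p (f y) = p (g y)"
  shows "p (cycle_prod a f x n) = p (cycle_prod a g x n)"
  using assms by (induction n) (simp_all add: cycle_prod_closed base_closed hom_mult[OF p])

text \<open>
  On each cycle pick a representative \<open>r\<close> and an element \<open>u r\<close> conjugating the cycle product of \<open>f\<close>
  to that of \<open>g\<close>. The required relation then forces the value of \<open>h\<close> at \<open>a\<^sup>k r\<close> to be \<open>H r k\<close>, and
  the choice of \<open>u r\<close> is exactly what makes \<open>H r\<close> periodic, so that \<open>h\<close> is well defined.
\<close>

lemma base_conj_if_cycle_prods_conj: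
  assumes fin: "finite (carrier B)" and f: "f \<in> carrier base" and g: "g \<in> carrier base"
    and a: "a \<in> carrier B"
    and conj: "\<And>x. x \<in> carrier B \<Longrightarrow>
      \<exists>u \<in> carrier A. u \<otimes>\<^bsub>A\<^esub> cycle_prod a f x (B.ord a) = cycle_prod a g x (B.ord a) \<otimes>\<^bsub>A\<^esub> u"
  shows "\<exists>h \<in> carrier base. \<forall>y \<in> carrier B. g y \<otimes>\<^bsub>A\<^esub> h (a \<otimes>\<^bsub>B\<^esub> y) = h y \<otimes>\<^bsub>A\<^esub> f y"
proof -
  let ?n = "B.ord a"
  have n: "?n \<ge> 1" "a [^]\<^bsub>B\<^esub> ?n = \<one>\<^bsub>B\<^esub>"
    using B.ord_ge_1[OF fin a] B.pow_ord_eq_1[OF a] by auto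
  obtain u where u: "\<And>x. x \<in> carrier B \<Longrightarrow> u x \<in> carrier A"
    "\<And>x. x \<in> carrier B \<Longrightarrow> u x \<otimes>\<^bsub>A\<^esub> cycle_prod a f x ?n = cycle_prod a g x ?n \<otimes>\<^bsub>A\<^esub> u x"
    using conj by metis
  \<comment> \<open>the value at \<open>a\<^sup>k r\<close> forced by the relation once the value at \<open>r\<close> is \<open>u r\<close>\<close>
  define H where "H r k = inv\<^bsub>A\<^esub> (cycle_prod a g r k) \<otimes>\<^bsub>A\<^esub> u r \<otimes>\<^bsub>A\<^esub> cycle_prod a f r k" for r k
  have H_closed: "H r k \<in> carrier A" if "r \<in> carrier B" for r k
    using that u f g a by (simp add: H_def cycle_prod_closed)
  have H_period: "H r (?n + k) = H r k" if r: "r \<in> carrier B" for r k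
  proof -
    let ?F = "cycle_prod a f r" and ?G = "cycle_prod a g r"
    have cl: "?F k \<in> carrier A" "?G k \<in> carrier A" "?F ?n \<in> carrier A" "?G ?n \<in> carrier A" "u r \<in> carrier A"
      using r u f g a by (simp_all add: cycle_prod_closed)
    have "?F (?n + k) = ?F ?n \<otimes>\<^bsub>A\<^esub> ?F k" "?G (?n + k) = ?G ?n \<otimes>\<^bsub>A\<^esub> ?G k"
      using cycle_prod_add[OF f a r, of ?n k] cycle_prod_add[OF g a r, of ?n k] n r by simp_all
    then have "H r (?n + k) = inv\<^bsub>A\<^esub> (?G k) \<otimes>\<^bsub>A\<^esub> (inv\<^bsub>A\<^esub> (?G ?n) \<otimes>\<^bsub>A\<^esub> (u r \<otimes>\<^bsub>A\<^esub> ?F ?n)) \<otimes>\<^bsub>A\<^esub> ?F k"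
      using cl by (simp add: H_def A.inv_mult_group A.m_assoc)
    also have "inv\<^bsub>A\<^esub> (?G ?n) \<otimes>\<^bsub>A\<^esub> (u r \<otimes>\<^bsub>A\<^esub> ?F ?n) = u r"
      unfolding u(2)[OF r] using cl by (simp flip: A.m_assoc)
    finally show ?thesis by (simp add: H_def)
  qed
  have H_period': "H r (?n * j + k) = H r k" if "r \<in> carrier B" for r j k
    using H_period[OF that] by (induction j) (simp_all add: add.assoc)
  have H_le: "H r k = H r l" if "r \<in> carrier B" "a [^]\<^bsub>B\<^esub> k \<otimes>\<^bsub>B\<^esub> r = a [^]\<^bsub>B\<^esub> l \<otimes>\<^bsub>B\<^esub> r" "k \<le> l" for r k l
  proof -
    have "a [^]\<^bsub>B\<^esub> k = a [^]\<^bsub>B\<^esub> l"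
      using that(1,2) a by simp
    also have "\<dots> = a [^]\<^bsub>B\<^esub> k \<otimes>\<^bsub>B\<^esub> a [^]\<^bsub>B\<^esub> (l - k)"
      using \<open>k \<le> l\<close> a by (simp add: B.nat_pow_mult)
    finally have "a [^]\<^bsub>B\<^esub> (l - k) = \<one>\<^bsub>B\<^esub>"
      using a by simp
    then obtain j where "l - k = ?n * j"
      using B.pow_eq_id[OF a] by (auto elim: dvdE)
    then have "l = ?n * j + k" using \<open>k \<le> l\<close> by simp
    then show ?thesis using H_period'[OF that(1)] by simp
  qed
  have H_eq: "H r k = H r l" if "r \<in> carrier B" "a [^]\<^bsub>B\<^esub> k \<otimes>\<^bsub>B\<^esub> r = a [^]\<^bsub>B\<^esub> l \<otimes>\<^bsub>B\<^esub> r" for r k l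
  proof (cases "k \<le> l")
    case True
    then show ?thesis by (rule H_le[OF that])
  next
    case False
    then show ?thesis using H_le[OF that(1) that(2)[symmetric]] by simp
  qed
  define rep where "rep x = (SOME r. r \<in> carrier B \<and> (\<exists>k::nat. x = a [^]\<^bsub>B\<^esub> k \<otimes>\<^bsub>B\<^esub> r))" for x
  have rep: "rep x \<in> carrier B \<and> (\<exists>k::nat. x = a [^]\<^bsub>B\<^esub> k \<otimes>\<^bsub>B\<^esub> rep x)" if "x \<in> carrier B" for x
    unfolding rep_def
    by (rule someI[of _ x]) (use that in \<open>auto intro: exI[of _ "0::nat"]\<close>)
  have rep_step: "rep (a \<otimes>\<^bsub>B\<^esub> x) = rep x" if x: "x \<in> carrier B" for x
  proof -
    have "(\<exists>k::nat. a \<otimes>\<^bsub>B\<^esub> x = a [^]\<^bsub>B\<^esub> k \<otimes>\<^bsub>B\<^esub> r) \<longleftrightarrow> (\<exists>k::nat. x = a [^]\<^bsub>B\<^esub> k \<otimes>\<^bsub>B\<^esub> r)"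
      if r: "r \<in> carrier B" for r
    proof
      assume "\<exists>k::nat. a \<otimes>\<^bsub>B\<^esub> x = a [^]\<^bsub>B\<^esub> k \<otimes>\<^bsub>B\<^esub> r"
      then obtain k :: nat where k: "a \<otimes>\<^bsub>B\<^esub> x = a [^]\<^bsub>B\<^esub> k \<otimes>\<^bsub>B\<^esub> r" by blast
      have "x = a [^]\<^bsub>B\<^esub> (?n - 1) \<otimes>\<^bsub>B\<^esub> (a \<otimes>\<^bsub>B\<^esub> x)"
        using n a x B.nat_pow_Suc[of a "?n - 1"] by (simp del: B.nat_pow_Suc flip: B.m_assoc)
      also have "\<dots> = a [^]\<^bsub>B\<^esub> (?n - 1 + k) \<otimes>\<^bsub>B\<^esub> r"
        unfolding k using a r by (simp add: B.m_assoc flip: B.nat_pow_mult)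
      finally show "\<exists>k::nat. x = a [^]\<^bsub>B\<^esub> k \<otimes>\<^bsub>B\<^esub> r" by blast
    next
      assume "\<exists>k::nat. x = a [^]\<^bsub>B\<^esub> k \<otimes>\<^bsub>B\<^esub> r"
      then obtain k :: nat where "x = a [^]\<^bsub>B\<^esub> k \<otimes>\<^bsub>B\<^esub> r" by blast
      then have "a \<otimes>\<^bsub>B\<^esub> x = a [^]\<^bsub>B\<^esub> Suc k \<otimes>\<^bsub>B\<^esub> r"
        using a r B.nat_pow_Suc2[OF a, of k] by (simp add: B.m_assoc del: B.nat_pow_Suc)
      then show "\<exists>k::nat. a \<otimes>\<^bsub>B\<^esub> x = a [^]\<^bsub>B\<^esub> k \<otimes>\<^bsub>B\<^esub> r" by blast
    qed
    then show ?thesis unfolding rep_def by (metis (no_types, lifting))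
  qed
  define h where "h = (\<lambda>x\<in>carrier B. H (rep x) (SOME k. x = a [^]\<^bsub>B\<^esub> k \<otimes>\<^bsub>B\<^esub> rep x))"
  have h_eq: "h x = H (rep x) k" if "x \<in> carrier B" "x = a [^]\<^bsub>B\<^esub> k \<otimes>\<^bsub>B\<^esub> rep x" for x and k :: nat
  proof -
    let ?k = "SOME k::nat. x = a [^]\<^bsub>B\<^esub> k \<otimes>\<^bsub>B\<^esub> rep x"
    have "x = a [^]\<^bsub>B\<^esub> ?k \<otimes>\<^bsub>B\<^esub> rep x"
      using that(2) by (rule someI)
    then have "H (rep x) ?k = H (rep x) k"
      using that(2) rep[OF that(1)] by (intro H_eq) (blast, rule trans[OF sym])
    then show ?thesis
      unfolding h_def using that(1) by simp
  qed
  have "h \<in> carrier base"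
    using fin H_closed rep by (simp add: base_iff h_def)
  moreover have "g y \<otimes>\<^bsub>A\<^esub> h (a \<otimes>\<^bsub>B\<^esub> y) = h y \<otimes>\<^bsub>A\<^esub> f y" if y: "y \<in> carrier B" for y
  proof -
    obtain k :: nat where r: "rep y \<in> carrier B" and k: "y = a [^]\<^bsub>B\<^esub> k \<otimes>\<^bsub>B\<^esub> rep y"
      using rep[OF y] by blast
    have "a \<otimes>\<^bsub>B\<^esub> y = a \<otimes>\<^bsub>B\<^esub> (a [^]\<^bsub>B\<^esub> k \<otimes>\<^bsub>B\<^esub> rep y)"
      using arg_cong[OF k] .
    also have "\<dots> = a [^]\<^bsub>B\<^esub> Suc k \<otimes>\<^bsub>B\<^esub> rep y"
      using a r B.nat_pow_Suc2[OF a, of k] by (simp add: B.m_assoc del: B.nat_pow_Suc)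
    finally have "h (a \<otimes>\<^bsub>B\<^esub> y) = H (rep y) (Suc k)"
      using h_eq[of "a \<otimes>\<^bsub>B\<^esub> y" "Suc k"] a y unfolding rep_step[OF y] by blast
    also have "\<dots> = inv\<^bsub>A\<^esub> (g y) \<otimes>\<^bsub>A\<^esub> (H (rep y) k \<otimes>\<^bsub>A\<^esub> f y)"
      using r u(1)[OF r] f g a y
      by (simp add: H_def k[symmetric] cycle_prod_closed base_closed A.inv_mult_group A.m_assoc)
    also have "\<dots> = inv\<^bsub>A\<^esub> (g y) \<otimes>\<^bsub>A\<^esub> (h y \<otimes>\<^bsub>A\<^esub> f y)"
      using h_eq[OF y k] by simp
    finally show ?thesis
      using f g y \<open>h \<in> carrier base\<close> by (simp add: base_closed flip: A.m_assoc)
  qed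
  ultimately show ?thesis by blast
qed

text \<open>
  For each \<open>c\<close> in the finite centraliser of \<open>b\<close> some point \<open>x c\<close> has non-conjugate cycle products. A
  quotient \<open>p\<close> of \<open>A\<close> that separates all these pairs suffices: a conjugate of \<open>(f, b)\<close> with the same
  image as \<open>(g, b)\<close> would have cycle products conjugate to those of the shifted \<open>f\<close> but with the same
  image under \<open>p\<close> as those of \<open>g\<close>.
\<close>

lemma separable_if_top_in_class:
  assumes C: "ext_closed_pseudovariety C" and A: "conjugacy_separable C A" and B: "in_class C B"
    and f: "f \<in> carrier base" and g: "g \<in> carrier base" and b: "b \<in> carrier B"
    and nconj: "(g, b) \<notin> conj_class W (f, b)"
  shows "\<exists>N \<in> class_normal C W. N #>\<^bsub>W\<^esub> (g, b) \<notin> (\<lambda>x. N #>\<^bsub>W\<^esub> x) ` conj_class W (f, b)"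
proof -
  have fin: "finite (carrier B)"
    by (rule in_class_finite[OF C B])
  define a where "a = inv\<^bsub>B\<^esub> b"
  have a: "a \<in> carrier B" using b by (simp add: a_def)
  let ?n = "B.ord a" and ?Z = "{c \<in> carrier B. c \<otimes>\<^bsub>B\<^esub> b = b \<otimes>\<^bsub>B\<^esub> c}"
  have fb: "(f, b) \<in> carrier W" "(g, b) \<in> carrier W"
    using f g b by (simp_all add: carrier_W)
  have "\<exists>x\<in>carrier B. cycle_prod a g x ?n \<notin> conj_class A (cycle_prod a (shift B c f) x ?n)"
    if c: "c \<in> ?Z" for c
  proof (rule ccontr)
    assume "\<not> ?thesis"
    then have "\<exists>h \<in> carrier base. \<forall>y \<in> carrier B. g y \<otimes>\<^bsub>A\<^esub> h (a \<otimes>\<^bsub>B\<^esub> y) = h y \<otimes>\<^bsub>A\<^esub> shift B c f y"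
      using c f g a
      by (intro base_conj_if_cycle_prods_conj[OF fin])
        (auto simp: shift_closed mem_conj_class_iff[OF A.group_axioms] cycle_prod_closed)
    then obtain h where h: "h \<in> carrier base"
      "\<And>y. y \<in> carrier B \<Longrightarrow> g y \<otimes>\<^bsub>A\<^esub> h (a \<otimes>\<^bsub>B\<^esub> y) = h y \<otimes>\<^bsub>A\<^esub> shift B c f y" by blast
    have "g \<otimes>\<^bsub>base\<^esub> shift B b h = h \<otimes>\<^bsub>base\<^esub> shift B c f"
      using h(2) by (auto simp: fun_eq_iff shift_apply a_def)
    then have "(h, c) \<otimes>\<^bsub>W\<^esub> (f, b) = (g, b) \<otimes>\<^bsub>W\<^esub> (h, c)"
      using c by (simp add: mult_W)
    then show False
      using nconj mem_conj_class_iff[OF group_W fb] h(1) c by (auto simp: carrier_W)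
  qed
  then have "\<forall>c\<in>?Z. \<exists>x. x \<in> carrier B \<and>
      cycle_prod a g x ?n \<notin> conj_class A (cycle_prod a (shift B c f) x ?n)" by blast
  from bchoice[OF this] obtain x where x: "\<And>c. c \<in> ?Z \<Longrightarrow> x c \<in> carrier B"
    "\<And>c. c \<in> ?Z \<Longrightarrow> cycle_prod a g (x c) ?n \<notin> conj_class A (cycle_prod a (shift B c f) (x c) ?n)"
    by blast
  define I where
    "I = (\<lambda>c. (cycle_prod a g (x c) ?n, conj_class A (cycle_prod a (shift B c f) (x c) ?n))) ` ?Z"
  have sepI: "class_separable C A S \<and> t \<in> carrier A - S" if "(t, S) \<in> I" for t S
    using that A x f g a
    by (auto simp: I_def conjugacy_separable_def cycle_prod_closed shift_closed)
  have "finite I" using fin by (simp add: I_def)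
  obtain A' :: "'a set monoid" and p where A': "in_class C A'" and p: "p \<in> hom A A'"
    and sep: "\<And>t S. (t, S) \<in> I \<Longrightarrow> p t \<notin> p ` S"
    using simultaneous_separation[OF C A.group_axioms \<open>finite I\<close> sepI] by metis
  interpret W': wreath A' B
    using in_class_group[OF A'] B.group_axioms by (simp add: wreath_def)
  let ?p = "\<lambda>(f, b). (map_base p f, b)"
  show ?thesis
  proof (rule hom_separates[OF C group_W conj_class_subset[OF group_W fb(1)]
        W'.in_class_W[OF C A' B] map_base_hom[OF W'.wreath_axioms p] fb(2)])
    show "?p (g, b) \<notin> ?p ` conj_class W (f, b)"
    proof
      assume "?p (g, b) \<in> ?p ` conj_class W (f, b)"
      then obtain q where q: "q \<in> conj_class W (f, b)" "?p (g, b) = ?p q"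
        by (rule imageE)
      then obtain k where k: "k \<in> carrier W" "q = k \<otimes>\<^bsub>W\<^esub> (f, b) \<otimes>\<^bsub>W\<^esub> inv\<^bsub>W\<^esub> k"
        unfolding conj_class_def by (blast elim: imageE)
      then obtain h c where h: "h \<in> carrier base" and c: "c \<in> carrier B" and hc: "k = (h, c)"
        unfolding carrier_W by blast
      let ?d = "c \<otimes>\<^bsub>B\<^esub> b \<otimes>\<^bsub>B\<^esub> inv\<^bsub>B\<^esub> c"
      let ?g = "h \<otimes>\<^bsub>base\<^esub> shift B c f \<otimes>\<^bsub>base\<^esub> inv\<^bsub>base\<^esub> (shift B b h)"
      have d: "b = ?d" and pg: "map_base p g = map_base p ?g"
        using q(2) unfolding k(2) hc conj_W[OF f b h c] by (simp_all del: mult_sum_group inv_sum_group)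
      have cZ: "c \<in> ?Z"
        using c b B.inv_solve_right[of b "c \<otimes>\<^bsub>B\<^esub> b" c] d by simp
      have g': "?g \<in> carrier base"
        using h c f b by (simp add: shift_closed del: mult_sum_group inv_sum_group)
      have "?g y \<otimes>\<^bsub>A\<^esub> h (a \<otimes>\<^bsub>B\<^esub> y) = h y \<otimes>\<^bsub>A\<^esub> shift B c f y" if y: "y \<in> carrier B" for y
        using y h c f b a
        by (simp add: mult_base inv_base shift_closed base_closed A.m_assoc
            shift_apply[of y b h] a_def[symmetric] del: mult_sum_group inv_sum_group)
      from cycle_prod_conj[OF shift_closed[OF f c] g' h a x(1)[OF cZ] this]
      have "cycle_prod a ?g (x c) ?n \<otimes>\<^bsub>A\<^esub> h (x c) = h (x c) \<otimes>\<^bsub>A\<^esub> cycle_prod a (shift B c f) (x c) ?n"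
        using a x(1)[OF cZ] B.pow_ord_eq_1[OF a] by (metis B.l_one)
      then have "cycle_prod a ?g (x c) ?n \<in> conj_class A (cycle_prod a (shift B c f) (x c) ?n)"
        using mem_conj_class_iff[OF A.group_axioms cycle_prod_closed[OF shift_closed[OF f c] a x(1)[OF cZ]]
            cycle_prod_closed[OF g' a x(1)[OF cZ]]] base_closed[OF h x(1)[OF cZ]] by metis
      moreover have "p (cycle_prod a g (x c) ?n) = p (cycle_prod a ?g (x c) ?n)"
      proof (rule hom_cycle_prod_cong[OF g g' a x(1)[OF cZ] p])
        show "p (g y) = p (?g y)" if "y \<in> carrier B" for y
          using fun_cong[OF pg, of y] that by (simp add: map_base_def del: mult_sum_group inv_sum_group)
      qed
      ultimately show False
        using sep[of "cycle_prod a g (x c) ?n"] cZ unfolding I_def by blast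
    qed
  qed
qed

end

section \<open>Orbit totals over an abelian base\<close>

lemma gfinprod_hom:
  assumes "comm_group G" "comm_group H" and p: "p \<in> hom G H" and f: "f \<in> I \<rightarrow> carrier G"
    and fin: "finite {i \<in> I. f i \<noteq> \<one>\<^bsub>G\<^esub>}"
  shows "p (gfinprod G f I) = gfinprod H (\<lambda>i. p (f i)) I"
proof -
  interpret G: comm_group G by fact
  interpret H: comm_group H by fact
  let ?J = "{i \<in> I. f i \<noteq> \<one>\<^bsub>G\<^esub>}"
  have one: "p \<one>\<^bsub>G\<^esub> = \<one>\<^bsub>H\<^esub>"
    using hom_one[OF p G.group_axioms H.group_axioms] .
  have *: "p (finprod G f J) = finprod H (\<lambda>i. p (f i)) J" if "finite J" "J \<subseteq> I" for J
    using that
  proof (induction J rule: finite_induct)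
    case (insert i J)
    then have "f i \<in> carrier G" "f \<in> J \<rightarrow> carrier G" "p (f i) \<in> carrier H" "(\<lambda>i. p (f i)) \<in> J \<rightarrow> carrier H"
      using f hom_in_carrier[OF p] by (auto simp: Pi_iff)
    then show ?case
      using insert by (simp add: hom_mult[OF p])
  qed (simp add: one)
  have "gfinprod H (\<lambda>i. p (f i)) I = gfinprod H (\<lambda>i. p (f i)) ?J"
    using f hom_in_carrier[OF p] one by (intro H.gfinprod_mono_neutral_cong_right) (auto simp: Pi_iff)
  also have "\<dots> = finprod H (\<lambda>i. p (f i)) ?J"
    using f hom_in_carrier[OF p] fin by (intro H.gfinprod_eq_finprod) (auto simp: Pi_iff)
  also have "\<dots> = p (gfinprod G f I)"
    using *[of ?J] fin by (auto simp: gfinprod_def)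
  finally show ?thesis by simp
qed

lemma (in group) telescope:
  assumes "x \<in> carrier G" "y \<in> carrier G" "z \<in> carrier G"
  shows "(x \<otimes> inv y) \<otimes> (y \<otimes> inv z) = x \<otimes> inv z"
proof -
  have "inv y \<otimes> (y \<otimes> inv z) = inv z"
    using assms by (simp flip: m_assoc)
  then show ?thesis
    using assms by (simp add: m_assoc)
qed

locale comm_wreath = wreath A B + A: comm_group A
  for A :: "('a, 'c) monoid_scheme" and B :: "('b, 'd) monoid_scheme"
begin

abbreviation total where "total f S \<equiv> gfinprod A f S"

lemma base_Pi: "f \<in> carrier base \<Longrightarrow> S \<subseteq> carrier B \<Longrightarrow> f \<in> S \<rightarrow> carrier A"
  by (auto simp: base_closed)

lemma total_closed: "f \<in> carrier base \<Longrightarrow> S \<subseteq> carrier B \<Longrightarrow> total f S \<in> carrier A"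
  by (rule A.gfinprod_closed[OF base_Pi])

lemma finite_support_within:
  "f \<in> carrier base \<Longrightarrow> S \<subseteq> carrier B \<Longrightarrow> finite {x \<in> S. f x \<noteq> \<one>\<^bsub>A\<^esub>}"
  by (rule finite_subset[OF _ base_finite]) auto

lemma total_mult:
  assumes "f \<in> carrier base" "g \<in> carrier base" "S \<subseteq> carrier B"
  shows "total (f \<otimes>\<^bsub>base\<^esub> g) S = total f S \<otimes>\<^bsub>A\<^esub> total g S"
proof -
  have "total (f \<otimes>\<^bsub>base\<^esub> g) S = total (\<lambda>x. f x \<otimes>\<^bsub>A\<^esub> g x) S"
    using assms by (intro A.gfinprod_cong) (auto simp: simp_implies_def base_closed subset_iff)
  then show ?thesis
    using assms by (simp add: A.gfinprod_distrib finite_support_within base_Pi del: mult_sum_group)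
qed

lemma total_support_cong:
  assumes f: "f \<in> carrier base" and S: "S \<subseteq> carrier B" "T \<subseteq> carrier B"
    and eq: "\<And>x. x \<in> carrier B \<Longrightarrow> f x \<noteq> \<one>\<^bsub>A\<^esub> \<Longrightarrow> x \<in> S \<longleftrightarrow> x \<in> T"
  shows "total f S = total f T"
proof -
  have "{x \<in> S. f x \<noteq> \<one>\<^bsub>A\<^esub>} = {x \<in> T. f x \<noteq> \<one>\<^bsub>A\<^esub>}"
    using S eq by blast
  then show ?thesis by (simp add: gfinprod_def)
qed

lemma total_empty: "total f {} = \<one>\<^bsub>A\<^esub>"
  by (simp add: gfinprod_def)

lemma total_ne_one_support:
  assumes f: "f \<in> carrier base" and S: "S \<subseteq> carrier B" and "total f S \<noteq> \<one>\<^bsub>A\<^esub>"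
  obtains x where "x \<in> S" "f x \<noteq> \<one>\<^bsub>A\<^esub>"
  using total_support_cong[OF f S, of "{}"] assms(3) total_empty by auto

lemma total_one: "S \<subseteq> carrier B \<Longrightarrow> total \<one>\<^bsub>base\<^esub> S = \<one>\<^bsub>A\<^esub>"
  using total_ne_one_support[OF base.one_closed, of S] one_base by (metis subsetD)

lemma total_inv:
  assumes "f \<in> carrier base" "S \<subseteq> carrier B"
  shows "total (inv\<^bsub>base\<^esub> f) S = inv\<^bsub>A\<^esub> (total f S)"
proof -
  have "total (inv\<^bsub>base\<^esub> f) S \<otimes>\<^bsub>A\<^esub> total f S = \<one>\<^bsub>A\<^esub>"
    using assms total_mult[of "inv\<^bsub>base\<^esub> f" f S] total_one[OF assms(2)]
    by (simp del: mult_sum_group inv_sum_group one_sum_group)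
  then show ?thesis
    using assms A.inv_equality total_closed base.inv_closed by metis
qed

lemma total_Un_disjoint:
  assumes f: "f \<in> carrier base" and "S \<subseteq> carrier B" "T \<subseteq> carrier B" "S \<inter> T = {}"
  shows "total f (S \<union> T) = total f S \<otimes>\<^bsub>A\<^esub> total f T"
proof -
  have "{x \<in> S \<union> T. f x \<noteq> \<one>\<^bsub>A\<^esub>} = {x \<in> S. f x \<noteq> \<one>\<^bsub>A\<^esub>} \<union> {x \<in> T. f x \<noteq> \<one>\<^bsub>A\<^esub>}" by auto
  moreover have "f \<in> {x \<in> S. f x \<noteq> \<one>\<^bsub>A\<^esub>} \<rightarrow> carrier A" "f \<in> {x \<in> T. f x \<noteq> \<one>\<^bsub>A\<^esub>} \<rightarrow> carrier A"
    using base_Pi[OF f assms(2)] base_Pi[OF f assms(3)] by auto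
  ultimately show ?thesis
    using assms finite_support_within[OF f assms(2)] finite_support_within[OF f assms(3)]
    by (simp add: gfinprod_def) (subst A.finprod_Un_disjoint; auto)
qed

lemma total_shift:
  assumes f: "f \<in> carrier base" and b: "b \<in> carrier B" and S: "S \<subseteq> carrier B"
  shows "total (shift B b f) S = total f {x \<in> carrier B. b \<otimes>\<^bsub>B\<^esub> x \<in> S}"
proof -
  let ?T = "{x \<in> carrier B. b \<otimes>\<^bsub>B\<^esub> x \<in> S}"
  let ?D = "{x \<in> ?T. f x \<noteq> \<one>\<^bsub>A\<^esub>}"
  have sh: "shift B b f (b \<otimes>\<^bsub>B\<^esub> x) = f x" if "x \<in> carrier B" for x
    using that b by (simp add: shift_apply flip: B.m_assoc)
  have eq: "{x \<in> S. shift B b f x \<noteq> \<one>\<^bsub>A\<^esub>} = (\<lambda>x. b \<otimes>\<^bsub>B\<^esub> x) ` ?D"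
  proof (intro equalityI subsetI)
    fix x assume x: "x \<in> {x \<in> S. shift B b f x \<noteq> \<one>\<^bsub>A\<^esub>}"
    then have "x \<in> carrier B" using S by auto
    then have "x = b \<otimes>\<^bsub>B\<^esub> (inv\<^bsub>B\<^esub> b \<otimes>\<^bsub>B\<^esub> x)" "inv\<^bsub>B\<^esub> b \<otimes>\<^bsub>B\<^esub> x \<in> ?D"
      using x b by (auto simp: shift_apply simp flip: B.m_assoc)
    then show "x \<in> (\<lambda>x. b \<otimes>\<^bsub>B\<^esub> x) ` ?D" by blast
  qed (auto simp: sh)
  have inj: "inj_on (\<lambda>x. b \<otimes>\<^bsub>B\<^esub> x) ?D"
    using b by (auto simp: inj_on_def)
  have fin: "finite ?D"
    by (rule finite_support_within[OF f]) auto
  have "finprod A (shift B b f) ((\<lambda>x. b \<otimes>\<^bsub>B\<^esub> x) ` ?D) = finprod A (\<lambda>x. shift B b f (b \<otimes>\<^bsub>B\<^esub> x)) ?D"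
    using f inj by (intro A.finprod_reindex) (auto simp: sh base_closed)
  also have "\<dots> = finprod A f ?D"
    using f by (intro A.finprod_cong') (auto simp: sh base_closed)
  finally show ?thesis
    using fin by (simp add: gfinprod_def eq)
qed

lemma total_single:
  assumes "s \<in> carrier A" "x \<in> carrier B" "S \<subseteq> carrier B"
  shows "total (single x s) S = (if x \<in> S then s else \<one>\<^bsub>A\<^esub>)"
proof (cases "x \<in> S")
  case True
  have "total (single x s) S = total (single x s) {x}"
    using assms True by (intro total_support_cong[OF single_closed]) (auto simp: single_def split: if_splits)
  also have "\<dots> = finprod A (single x s) {x}"
    using assms by (intro A.gfinprod_eq_finprod) (auto simp: single_def)
  also have "\<dots> = s"
    using assms by (simp add: A.finprod_insert single_def)
  finally show ?thesis using True by simp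
next
  case False
  have "total (single x s) S = total (single x s) {}"
    using assms False
    by (intro total_support_cong[OF single_closed]) (auto simp: single_def split: if_splits)
  then show ?thesis
    using False by (simp add: total_empty)
qed

text \<open>
  The right coset of \<open>H\<close> through \<open>x\<close>, that is, the orbit of \<open>x\<close> under left multiplication by \<open>H\<close>,
  written so that membership is a statement about a single quotient of elements.
\<close>

definition orb :: "'b set \<Rightarrow> 'b \<Rightarrow> 'b set" where
  "orb H x = {y \<in> carrier B. y \<otimes>\<^bsub>B\<^esub> inv\<^bsub>B\<^esub> x \<in> H}"

lemma orb_subset: "orb H x \<subseteq> carrier B"
  by (auto simp: orb_def)

lemma orb_translate:
  assumes H: "subgroup H B" and h: "h \<in> H" and x: "x \<in> carrier B" and y: "y \<in> carrier B"
  shows "h \<otimes>\<^bsub>B\<^esub> y \<in> orb H x \<longleftrightarrow> y \<in> orb H x" "y \<in> orb H (h \<otimes>\<^bsub>B\<^esub> x) \<longleftrightarrow> y \<in> orb H x"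
proof -
  interpret H: subgroup H B by fact
  have hB: "h \<in> carrier B" using h by auto
  have *: "z \<in> H \<longleftrightarrow> h \<otimes>\<^bsub>B\<^esub> z \<in> H" "z \<in> H \<longleftrightarrow> z \<otimes>\<^bsub>B\<^esub> inv\<^bsub>B\<^esub> h \<in> H" if z: "z \<in> carrier B" for z
  proof -
    have "z = inv\<^bsub>B\<^esub> h \<otimes>\<^bsub>B\<^esub> (h \<otimes>\<^bsub>B\<^esub> z)" "z = z \<otimes>\<^bsub>B\<^esub> inv\<^bsub>B\<^esub> h \<otimes>\<^bsub>B\<^esub> h"
      using z hB by (simp_all add: B.m_assoc flip: B.m_assoc[of "inv\<^bsub>B\<^esub> h" h])
    then show "z \<in> H \<longleftrightarrow> h \<otimes>\<^bsub>B\<^esub> z \<in> H" "z \<in> H \<longleftrightarrow> z \<otimes>\<^bsub>B\<^esub> inv\<^bsub>B\<^esub> h \<in> H"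
      using h H.m_closed H.m_inv_closed by metis+
  qed
  show "h \<otimes>\<^bsub>B\<^esub> y \<in> orb H x \<longleftrightarrow> y \<in> orb H x" 
    using *(1)[of "y \<otimes>\<^bsub>B\<^esub> inv\<^bsub>B\<^esub> x"] hB x y by (simp add: orb_def B.m_assoc)
  show "y \<in> orb H (h \<otimes>\<^bsub>B\<^esub> x) \<longleftrightarrow> y \<in> orb H x"
    using *(2)[of "y \<otimes>\<^bsub>B\<^esub> inv\<^bsub>B\<^esub> x"] hB x y by (simp add: orb_def B.m_assoc B.inv_mult_group)
qed

text \<open>
  Shifting by an element of \<open>H\<close> permutes each orbit of \<open>H\<close> and hence preserves its total.
\<close>

lemma total_coboundary:
  assumes H: "subgroup H B" and d: "d \<in> H" and h: "h \<in> carrier base" and x: "x \<in> carrier B"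
  shows "total (h \<otimes>\<^bsub>base\<^esub> inv\<^bsub>base\<^esub> (shift B d h)) (orb H x) = \<one>\<^bsub>A\<^esub>"
proof -
  have dB: "d \<in> carrier B" using subgroup.mem_carrier[OF H d] .
  have "{y \<in> carrier B. d \<otimes>\<^bsub>B\<^esub> y \<in> orb H x} = orb H x"
    using orb_translate(1)[OF H d x] orb_subset by blast
  then have "total (shift B d h) (orb H x) = total h (orb H x)"
    by (simp add: total_shift[OF h dB orb_subset])
  then show ?thesis
    using h dB by (simp add: total_mult total_inv shift_closed total_closed orb_subset
        del: mult_sum_group inv_sum_group)
qed

text \<open>
  The base components by which conjugation with base elements can change \<open>(f, b)\<close>; in the abelian case
  these are the coboundaries of the cyclic group generated by \<open>b\<close> acting on the base.
\<close>

definition coboundaries :: "'b \<Rightarrow> ('b \<Rightarrow> 'a) set" where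
  "coboundaries b = (\<lambda>h. h \<otimes>\<^bsub>base\<^esub> inv\<^bsub>base\<^esub> (shift B b h)) ` carrier base"

lemma comm_base: "comm_group base"
proof (rule base.group_comm_groupI)
  fix f g assume "f \<in> carrier base" "g \<in> carrier base"
  then show "f \<otimes>\<^bsub>base\<^esub> g = g \<otimes>\<^bsub>base\<^esub> f"
    by (intro base_eqI) (simp_all add: base_closed A.m_comm mult_base del: mult_sum_group)
qed

sublocale base: comm_group base
  by (rule comm_base)

lemma coboundaries_subgroup:
  assumes b: "b \<in> carrier B"
  shows "subgroup (coboundaries b) base"
proof (rule base.subgroupI)
  show "coboundaries b \<subseteq> carrier base"
    using b by (auto simp: coboundaries_def shift_closed simp del: mult_sum_group inv_sum_group)
  show "coboundaries b \<noteq> {}"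
    using base.one_closed by (auto simp: coboundaries_def)
next
  fix u assume "u \<in> coboundaries b"
  then obtain h where h: "h \<in> carrier base" "u = h \<otimes>\<^bsub>base\<^esub> inv\<^bsub>base\<^esub> (shift B b h)"
    by (auto simp: coboundaries_def)
  then have "inv\<^bsub>base\<^esub> u = inv\<^bsub>base\<^esub> h \<otimes>\<^bsub>base\<^esub> inv\<^bsub>base\<^esub> (shift B b (inv\<^bsub>base\<^esub> h))"
    using b by (simp add: base.inv_mult shift_inv shift_closed del: mult_sum_group inv_sum_group)
  then show "inv\<^bsub>base\<^esub> u \<in> coboundaries b"
    unfolding coboundaries_def using h(1) base.inv_closed by blast
next
  fix u v assume "u \<in> coboundaries b" "v \<in> coboundaries b"
  then obtain h k where h: "h \<in> carrier base" "u = h \<otimes>\<^bsub>base\<^esub> inv\<^bsub>base\<^esub> (shift B b h)"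
    and k: "k \<in> carrier base" "v = k \<otimes>\<^bsub>base\<^esub> inv\<^bsub>base\<^esub> (shift B b k)"
    by (auto simp: coboundaries_def)
  then have "u \<otimes>\<^bsub>base\<^esub> v = (h \<otimes>\<^bsub>base\<^esub> k) \<otimes>\<^bsub>base\<^esub> inv\<^bsub>base\<^esub> (shift B b (h \<otimes>\<^bsub>base\<^esub> k))"
    using b by (simp add: base.inv_mult shift_mult shift_closed base.m_ac del: mult_sum_group inv_sum_group)
  then show "u \<otimes>\<^bsub>base\<^esub> v \<in> coboundaries b"
    unfolding coboundaries_def using h(1) k(1) base.m_closed by blast
qed

text \<open>
  Modulo coboundaries a single value may be moved from \<open>x\<close> to \<open>b x\<close>, hence to any point of the orbit.
\<close>

lemma single_move_coboundary:
  assumes b: "b \<in> carrier B" and s: "s \<in> carrier A" and t: "t \<in> generate B {b}" and x: "x \<in> carrier B"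
  shows "single x s \<otimes>\<^bsub>base\<^esub> inv\<^bsub>base\<^esub> (single (t \<otimes>\<^bsub>B\<^esub> x) s) \<in> coboundaries b"
  using t x
proof (induction arbitrary: x rule: generate.induct)
  case one
  have "\<one>\<^bsub>base\<^esub> \<in> coboundaries b"
    by (rule subgroup.one_closed[OF coboundaries_subgroup[OF b]])
  then show ?case
    using one single_closed[OF s] by (simp del: mult_sum_group inv_sum_group one_sum_group)
next
  case (incl t)
  then have "t = b" by simp
  then show ?case
    unfolding coboundaries_def using incl single_closed[OF s, of x] b shift_single[OF b incl(2), of s]
    by (intro image_eqI[of _ _ "single x s"]) (simp_all del: mult_sum_group inv_sum_group)
next
  case (inv t)
  then have t: "t = b" by simp
  let ?y = "inv\<^bsub>B\<^esub> b \<otimes>\<^bsub>B\<^esub> x"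
  have y: "?y \<in> carrier B" "b \<otimes>\<^bsub>B\<^esub> ?y = x"
    using b inv by (simp_all flip: B.m_assoc)
  have "single ?y s \<otimes>\<^bsub>base\<^esub> inv\<^bsub>base\<^esub> (single x s) \<in> coboundaries b"
    unfolding coboundaries_def using single_closed[OF s, of ?y] b shift_single[OF b y(1), of s] y(2)
    by (intro image_eqI[of _ _ "single ?y s"]) (simp_all del: mult_sum_group inv_sum_group)
  from subgroup.m_inv_closed[OF coboundaries_subgroup[OF b] this]
  show ?case
    unfolding t using single_closed[OF s]
    by (simp add: base.inv_mult base.m_comm del: mult_sum_group inv_sum_group)
next
  case (eng t1 t2)
  have B: "t1 \<in> carrier B" "t2 \<in> carrier B"
    using eng(1,2) b by (auto intro: B.generate_in_carrier[of "{b}"])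
  let ?s = "\<lambda>x. single x s"
  have "?s x \<otimes>\<^bsub>base\<^esub> inv\<^bsub>base\<^esub> (?s (t2 \<otimes>\<^bsub>B\<^esub> x)) \<in> coboundaries b"
    "?s (t2 \<otimes>\<^bsub>B\<^esub> x) \<otimes>\<^bsub>base\<^esub> inv\<^bsub>base\<^esub> (?s (t1 \<otimes>\<^bsub>B\<^esub> (t2 \<otimes>\<^bsub>B\<^esub> x))) \<in> coboundaries b"
    using eng B by (simp_all del: mult_sum_group inv_sum_group)
  from subgroup.m_closed[OF coboundaries_subgroup[OF b] this]
  show ?case
    using B eng.prems single_closed[OF s] by (simp only: base.telescope B.m_assoc)
qed

text \<open>
  Induction on the size of the support: if \<open>f\<close> does not vanish at \<open>x\<close>, triviality of the total forces
  a second support point \<open>y\<close> in the same orbit, and moving the value at \<open>x\<close> to \<open>y\<close> removes \<open>x\<close> from the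
  support and adds no point. This works for \<open>b\<close> of finite or infinite order.
\<close>

lemma coboundary_if_totals_trivial:
  assumes b: "b \<in> carrier B" and f: "f \<in> carrier base"
    and tot: "\<And>x. x \<in> carrier B \<Longrightarrow> total f (orb (generate B {b}) x) = \<one>\<^bsub>A\<^esub>"
  shows "f \<in> coboundaries b"
  using f tot
proof (induction "card {x \<in> carrier B. f x \<noteq> \<one>\<^bsub>A\<^esub>}" arbitrary: f rule: less_induct)
  case (less f)
  let ?H = "generate B {b}" and ?supp = "\<lambda>f. {x \<in> carrier B. f x \<noteq> \<one>\<^bsub>A\<^esub>}"
  have H: "subgroup ?H B"
    using b by (intro B.generate_is_subgroup) auto
  have sub: "subgroup (coboundaries b) base"
    by (rule coboundaries_subgroup[OF b])
  show ?case
  proof (cases "?supp f = {}")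
    case True
    then have "f = \<one>\<^bsub>base\<^esub>"
      using less.prems(1) base.one_closed by (intro base_eqI) auto
    then show ?thesis using subgroup.one_closed[OF sub] by simp
  next
    case False
    then obtain x where x: "x \<in> carrier B" "f x \<noteq> \<one>\<^bsub>A\<^esub>" by blast
    have fx: "f x \<in> carrier A" using base_closed[OF less.prems(1) x(1)] .
    have xx: "x \<in> orb ?H x"
      using x(1) subgroup.one_closed[OF H] by (simp add: orb_def)
    \<comment> \<open>otherwise the total over the orbit would be the non-trivial value at \<open>x\<close>\<close>
    have "\<exists>y \<in> orb ?H x. y \<noteq> x \<and> f y \<noteq> \<one>\<^bsub>A\<^esub>"
    proof (rule ccontr)
      assume "\<not> ?thesis"
      then have "total f (orb ?H x) = total (single x (f x)) (orb ?H x)"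
        using less.prems(1) x(1) fx orb_subset[of ?H x]
        by (intro A.gfinprod_cong) (auto simp: single_def simp_implies_def)
      then show False
        using less.prems(2)[OF x(1)] x fx xx by (simp add: total_single orb_subset)
    qed
    then obtain y where y: "y \<in> orb ?H x" "y \<noteq> x" "f y \<noteq> \<one>\<^bsub>A\<^esub>" by blast
    have yB: "y \<in> carrier B" using y(1) orb_subset by blast
    let ?u = "single x (f x) \<otimes>\<^bsub>base\<^esub> inv\<^bsub>base\<^esub> (single y (f x))"
    have "(y \<otimes>\<^bsub>B\<^esub> inv\<^bsub>B\<^esub> x) \<otimes>\<^bsub>B\<^esub> x = y"
      using x(1) yB by (simp add: B.m_assoc)
    then have u: "?u \<in> coboundaries b"
      using single_move_coboundary[OF b fx _ x(1), of "y \<otimes>\<^bsub>B\<^esub> inv\<^bsub>B\<^esub> x"] y(1) unfolding orb_def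
      by (simp del: mult_sum_group inv_sum_group)
    have uB: "?u \<in> carrier base"
      using single_closed[OF fx] by (simp del: mult_sum_group inv_sum_group)
    let ?g = "f \<otimes>\<^bsub>base\<^esub> inv\<^bsub>base\<^esub> ?u"
    have gB: "?g \<in> carrier base"
      using less.prems(1) uB by (simp del: mult_sum_group inv_sum_group)
    have g_val: "?g z = f z \<otimes>\<^bsub>A\<^esub> inv\<^bsub>A\<^esub> (single x (f x) z \<otimes>\<^bsub>A\<^esub> inv\<^bsub>A\<^esub> (single y (f x) z))"
      if "z \<in> carrier B" for z
      using that single_closed[OF fx] uB by (simp add: mult_base inv_base del: mult_sum_group inv_sum_group)
    have "?supp ?g \<subseteq> ?supp f - {x}"
    proof
      fix z assume "z \<in> ?supp ?g"
      then have z: "z \<in> carrier B" "?g z \<noteq> \<one>\<^bsub>A\<^esub>" by auto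
      then show "z \<in> ?supp f - {x}"
        using g_val[OF z(1)] x(1) y(2,3) fx base_closed[OF less.prems(1) z(1)]
        by (cases "z = x"; cases "z = y") (simp_all add: single_def del: mult_sum_group inv_sum_group)
    qed
    then have "?supp ?g \<subset> ?supp f" using x by blast
    then have "card (?supp ?g) < card (?supp f)"
      by (rule psubset_card_mono[OF base_finite[OF less.prems(1)]])
    moreover have "total ?g (orb ?H z) = \<one>\<^bsub>A\<^esub>" if z: "z \<in> carrier B" for z
    proof -
      obtain h where h: "h \<in> carrier base" "?u = h \<otimes>\<^bsub>base\<^esub> inv\<^bsub>base\<^esub> (shift B b h)"
        using u unfolding coboundaries_def by blast
      have "b \<in> ?H" by (simp add: generate.incl)
      then have "total ?u (orb ?H z) = \<one>\<^bsub>A\<^esub>"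
        unfolding h(2) using total_coboundary[OF H _ h(1) z] by blast
      then show ?thesis
        using less.prems uB z by (simp add: total_mult total_inv orb_subset del: mult_sum_group inv_sum_group)
    qed
    ultimately have "?g \<in> coboundaries b"
      using less.hyps gB by blast
    from subgroup.m_closed[OF sub this u] show ?thesis
      using less.prems(1) uB by (simp add: base.m_assoc del: mult_sum_group inv_sum_group one_sum_group)
  qed
qed

end

section \<open>Quotients of the top group\<close>

context comm_wreath
begin

text \<open>
  The base component of the map \<open>A wr B \<rightarrow> A wr B'\<close> induced by \<open>q\<close>; commutativity of \<open>A\<close> is what makes
  the product over a fibre meaningful.
\<close>

definition push :: "('b \<Rightarrow> 'e) \<Rightarrow> ('e, 'f) monoid_scheme \<Rightarrow> ('b \<Rightarrow> 'a) \<Rightarrow> 'e \<Rightarrow> 'a" where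
  "push q B' f = (\<lambda>y\<in>carrier B'. total f {x \<in> carrier B. q x = y})"

lemma push_closed:
  assumes "group B'" and q: "q \<in> hom B B'" and f: "f \<in> carrier base"
  shows "push q B' f \<in> carrier (sum_group (carrier B') (\<lambda>_. A))"
proof -
  interpret W': comm_wreath A B'
    using assms(1) A.comm_group_axioms A.group_axioms by (simp add: comm_wreath_def wreath_def)
  have "y \<in> q ` {x \<in> carrier B. f x \<noteq> \<one>\<^bsub>A\<^esub>}" if "total f {x \<in> carrier B. q x = y} \<noteq> \<one>\<^bsub>A\<^esub>" for y
    using total_ne_one_support[OF f _ that] by blast
  then have "{y \<in> carrier B'. push q B' f y \<noteq> \<one>\<^bsub>A\<^esub>} \<subseteq> q ` {x \<in> carrier B. f x \<noteq> \<one>\<^bsub>A\<^esub>}"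
    by (auto simp: push_def)
  then have "finite {y \<in> carrier B'. push q B' f y \<noteq> \<one>\<^bsub>A\<^esub>}"
    using base_finite[OF f] by (meson finite_imageI finite_subset)
  moreover have "total f {x \<in> carrier B. q x = y} \<in> carrier A" for y
    using f by (intro total_closed) auto
  ultimately show ?thesis
    by (auto simp: W'.base_iff push_def)
qed

lemma push_hom:
  assumes "group B'" and q: "q \<in> hom B B'"
  shows "(\<lambda>(f, b). (push q B' f, q b)) \<in> hom W (wreath_product A B')"
proof -
  interpret W': comm_wreath A B'
    using assms(1) A.comm_group_axioms A.group_axioms by (simp add: comm_wreath_def wreath_def)
  interpret q: group_hom B B' q
    using q B.group_axioms W'.B.group_axioms by (simp add: group_hom_def group_hom_axioms_def)
  have "push q B' (f \<otimes>\<^bsub>base\<^esub> shift B b g) = push q B' f \<otimes>\<^bsub>W'.base\<^esub> shift B' (q b) (push q B' g)"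
    if fg: "f \<in> carrier base" "g \<in> carrier base" and b: "b \<in> carrier B" for f g b
  proof (rule W'.base_eqI)
    show "push q B' (f \<otimes>\<^bsub>base\<^esub> shift B b g) \<in> carrier W'.base"
      using fg b by (intro push_closed[OF assms] base.m_closed shift_closed)
    show "push q B' f \<otimes>\<^bsub>W'.base\<^esub> shift B' (q b) (push q B' g) \<in> carrier W'.base"
      using fg b by (intro W'.base.m_closed W'.shift_closed push_closed[OF assms] q.hom_closed)
    fix y assume y: "y \<in> carrier B'"
    have eq: "q (b \<otimes>\<^bsub>B\<^esub> x) = y \<longleftrightarrow> q x = inv\<^bsub>B'\<^esub> (q b) \<otimes>\<^bsub>B'\<^esub> y" if "x \<in> carrier B" for x
      using that b y
      by (metis (no_types, lifting) W'.B.inv_closed W'.B.l_inv W'.B.l_one W'.B.m_assoc W'.B.r_inv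
          q.hom_closed q.hom_mult)
    have "push q B' (f \<otimes>\<^bsub>base\<^esub> shift B b g) y =
        total f {x \<in> carrier B. q x = y} \<otimes>\<^bsub>A\<^esub> total (shift B b g) {x \<in> carrier B. q x = y}"
      using y fg b by (simp add: push_def total_mult shift_closed del: mult_sum_group)
    also have "total (shift B b g) {x \<in> carrier B. q x = y}
        = total g {x \<in> carrier B. b \<otimes>\<^bsub>B\<^esub> x \<in> {x \<in> carrier B. q x = y}}"
      using fg b by (intro total_shift) auto
    also have "{x \<in> carrier B. b \<otimes>\<^bsub>B\<^esub> x \<in> {x \<in> carrier B. q x = y}}
        = {x \<in> carrier B. q x = inv\<^bsub>B'\<^esub> (q b) \<otimes>\<^bsub>B'\<^esub> y}"
      using eq b by (auto simp del: q.hom_mult)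
    finally show "push q B' (f \<otimes>\<^bsub>base\<^esub> shift B b g) y =
        (push q B' f \<otimes>\<^bsub>W'.base\<^esub> shift B' (q b) (push q B' g)) y"
      using y b by (simp add: push_def W'.mult_base W'.shift_apply del: mult_sum_group)
  qed
  then show ?thesis
    using push_closed[OF assms]
    by (auto simp: hom_def carrier_W W'.carrier_W mult_W W'.mult_W
        simp del: mult_sum_group)
qed

text \<open>
  The total over a union of fibres is a product of totals over fibres, and only the finitely many fibres
  that meet a support contribute.
\<close>

lemma total_vimage_if_push_eq:
  assumes "group B'" and q: "q \<in> hom B B'" and f: "f \<in> carrier base" and g: "g \<in> carrier base"
    and eq: "push q B' f = push q B' g"
  shows "total f {x \<in> carrier B. q x \<in> S} = total g {x \<in> carrier B. q x \<in> S}"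
proof -
  let ?supp = "\<lambda>f. {x \<in> carrier B. f x \<noteq> \<one>\<^bsub>A\<^esub>}"
  let ?V = "\<lambda>S. {x \<in> carrier B. q x \<in> S}"
  have *: "total f (?V T) = total g (?V T)" if "finite T" "T \<subseteq> carrier B'" for T
    using that
  proof (induction T rule: finite_induct)
    case (insert y T)
    have V: "?V (insert y T) = ?V {y} \<union> ?V T" "?V {y} \<inter> ?V T = {}"
      using insert by auto
    have "total f (?V {y}) = total g (?V {y})"
      using fun_cong[OF eq, of y] insert.prems by (simp add: push_def)
    then show ?case
      unfolding V(1) using insert V(2) f g by (simp add: total_Un_disjoint)
  qed (simp add: total_empty)
  let ?T = "S \<inter> q ` (?supp f \<union> ?supp g)"
  have "total f (?V S) = total f (?V ?T)" "total g (?V S) = total g (?V ?T)"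
    by (rule total_support_cong[OF f], auto)+ (rule total_support_cong[OF g], auto)
  moreover have "finite ?T" "?T \<subseteq> carrier B'"
    using base_finite[OF f] base_finite[OF g] hom_in_carrier[OF q] by auto
  ultimately show ?thesis using *[of ?T] by simp
qed

text \<open>
  The elements whose image commutes with the image of \<open>c\<close> form a subgroup.
\<close>

lemma hom_commutes_with_generated:
  assumes "group B'" and q: "q \<in> hom B B'" and c: "c \<in> carrier B" and b: "b \<in> carrier B"
    and comm: "q (c \<otimes>\<^bsub>B\<^esub> b) = q (b \<otimes>\<^bsub>B\<^esub> c)" and t: "t \<in> generate B {b}"
  shows "q (c \<otimes>\<^bsub>B\<^esub> t) = q (t \<otimes>\<^bsub>B\<^esub> c)"
proof -
  interpret q: group_hom B B' q
    using assms(1) q B.group_axioms by (simp add: group_hom_def group_hom_axioms_def)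
  let ?Z = "{t \<in> carrier B. q c \<otimes>\<^bsub>B'\<^esub> q t = q t \<otimes>\<^bsub>B'\<^esub> q c}"
  have "subgroup ?Z B"
  proof (rule B.subgroupI)
    show "?Z \<noteq> {}" using c by (auto intro!: exI[of _ "\<one>\<^bsub>B\<^esub>"])
  next
    fix t assume "t \<in> ?Z"
    then have t: "t \<in> carrier B" "q c \<otimes>\<^bsub>B'\<^esub> q t = q t \<otimes>\<^bsub>B'\<^esub> q c" by auto
    have "q c \<otimes>\<^bsub>B'\<^esub> inv\<^bsub>B'\<^esub> (q t) = inv\<^bsub>B'\<^esub> (q t) \<otimes>\<^bsub>B'\<^esub> (q t \<otimes>\<^bsub>B'\<^esub> q c) \<otimes>\<^bsub>B'\<^esub> inv\<^bsub>B'\<^esub> (q t)"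
      using t(1) c by (simp flip: q.H.m_assoc)
    also have "\<dots> = inv\<^bsub>B'\<^esub> (q t) \<otimes>\<^bsub>B'\<^esub> q c"
      unfolding t(2)[symmetric] using t(1) c by (simp add: q.H.m_assoc)
    finally show "inv\<^bsub>B\<^esub> t \<in> ?Z" using t(1) by simp
  next
    fix s t assume "s \<in> ?Z" "t \<in> ?Z"
    then have st: "s \<in> carrier B" "t \<in> carrier B"
      "q c \<otimes>\<^bsub>B'\<^esub> q s = q s \<otimes>\<^bsub>B'\<^esub> q c" "q c \<otimes>\<^bsub>B'\<^esub> q t = q t \<otimes>\<^bsub>B'\<^esub> q c" by auto
    have "q c \<otimes>\<^bsub>B'\<^esub> (q s \<otimes>\<^bsub>B'\<^esub> q t) = (q s \<otimes>\<^bsub>B'\<^esub> q c) \<otimes>\<^bsub>B'\<^esub> q t"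
      unfolding st(3)[symmetric] using st(1,2) c by (simp add: q.H.m_assoc)
    also have "\<dots> = q s \<otimes>\<^bsub>B'\<^esub> (q t \<otimes>\<^bsub>B'\<^esub> q c)"
      unfolding st(4)[symmetric] using st(1,2) c by (simp add: q.H.m_assoc)
    finally show "s \<otimes>\<^bsub>B\<^esub> t \<in> ?Z" using st(1,2) c by (simp add: q.H.m_assoc)
  qed auto
  moreover have "{b} \<subseteq> ?Z" using b c comm by simp
  ultimately have "generate B {b} \<subseteq> ?Z"
    by (intro B.generate_subgroup_incl)
  then show ?thesis using t c by auto
qed

text \<open>
  The preimage in \<open>B\<close> of the cyclic subgroup generated by \<open>q b\<close>. Its orbits are the preimages of the
  orbits of \<open>q b\<close> in the quotient, so totals in the quotient can be computed inside \<open>B\<close>.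
\<close>

definition saturation :: "('b \<Rightarrow> 'e) \<Rightarrow> 'b \<Rightarrow> 'b set" where
  "saturation q b = {z \<in> carrier B. q z \<in> q ` generate B {b}}"

lemma saturation_subgroup:
  assumes "group B'" and q: "q \<in> hom B B'" and b: "b \<in> carrier B"
  shows "subgroup (saturation q b) B"
proof -
  interpret q: group_hom B B' q
    using assms(1) q B.group_axioms by (simp add: group_hom_def group_hom_axioms_def)
  have H: "subgroup (generate B {b}) B"
    using b by (intro B.generate_is_subgroup) auto
  have "subgroup (q ` generate B {b}) B'"
    by (rule q.subgroup_img_is_subgroup[OF H])
  then interpret K: subgroup "q ` generate B {b}" B' .
  show ?thesis
    unfolding saturation_def
    by (rule B.subgroupI) (auto intro: exI[of _ "\<one>\<^bsub>B\<^esub>"] K.m_closed K.m_inv_closed simp del: image_iff)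
qed

lemma generate_le_saturation: "b \<in> carrier B \<Longrightarrow> generate B {b} \<subseteq> saturation q b"
  using B.generate_in_carrier[of "{b}"] by (auto simp: saturation_def)

lemma orb_saturation_translate:
  assumes "group B'" and q: "q \<in> hom B B'" and b: "b \<in> carrier B" and c: "c \<in> carrier B"
    and comm: "q (c \<otimes>\<^bsub>B\<^esub> b) = q (b \<otimes>\<^bsub>B\<^esub> c)" and x: "x \<in> carrier B" and y: "y \<in> carrier B"
  shows "c \<otimes>\<^bsub>B\<^esub> y \<in> orb (saturation q b) (c \<otimes>\<^bsub>B\<^esub> x) \<longleftrightarrow> y \<in> orb (saturation q b) x"
proof -
  interpret q: group_hom B B' q
    using assms(1) q B.group_axioms by (simp add: group_hom_def group_hom_axioms_def)
  let ?z = "y \<otimes>\<^bsub>B\<^esub> inv\<^bsub>B\<^esub> x"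
  have z: "?z \<in> carrier B" using x y by simp
  have eq: "c \<otimes>\<^bsub>B\<^esub> y \<otimes>\<^bsub>B\<^esub> inv\<^bsub>B\<^esub> (c \<otimes>\<^bsub>B\<^esub> x) = c \<otimes>\<^bsub>B\<^esub> ?z \<otimes>\<^bsub>B\<^esub> inv\<^bsub>B\<^esub> c"
    using c x y by (simp add: B.inv_mult_group B.m_assoc)
  have "q (c \<otimes>\<^bsub>B\<^esub> ?z \<otimes>\<^bsub>B\<^esub> inv\<^bsub>B\<^esub> c) = q t \<longleftrightarrow> q ?z = q t" if t: "t \<in> generate B {b}" for t
  proof -
    have tB: "t \<in> carrier B" using t b B.generate_in_carrier[of "{b}"] by auto
    have ct: "q c \<otimes>\<^bsub>B'\<^esub> q t = q t \<otimes>\<^bsub>B'\<^esub> q c"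
      using hom_commutes_with_generated[OF assms(1) q c b comm t] c tB by simp
    have "q (c \<otimes>\<^bsub>B\<^esub> ?z \<otimes>\<^bsub>B\<^esub> inv\<^bsub>B\<^esub> c) = q t \<longleftrightarrow> q c \<otimes>\<^bsub>B'\<^esub> q ?z = q t \<otimes>\<^bsub>B'\<^esub> q c"
      using q.H.inv_solve_right'[of "q t" "q c \<otimes>\<^bsub>B'\<^esub> q ?z" "q c"] c z tB by simp
    also have "\<dots> \<longleftrightarrow> q ?z = q t"
      unfolding ct[symmetric] using c z tB by simp
    finally show ?thesis .
  qed
  then show ?thesis
    using c x y z by (simp add: orb_def saturation_def image_iff eq del: q.hom_mult q.hom_inv)
qed

text \<open>
  What conjugacy in the quotient \<open>A' wr B'\<close> means in terms of totals in \<open>A\<close>: the conjugate \<open>k\<close> of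
  \<open>(f, b)\<close> has the same image as \<open>(g, b)\<close>. The coboundary contributed by \<open>h\<close> disappears from the totals,
  since its shift \<open>c b c\<^sup>-\<^sup>1\<close> has the same image as \<open>b\<close> and so lies in the saturation.
\<close>

lemma totals_if_images_conj:
  assumes "comm_group A'" and p: "p \<in> hom A A'" and "group B'" and q: "q \<in> hom B B'"
    and f: "f \<in> carrier base" and g: "g \<in> carrier base" and b: "b \<in> carrier B"
    and h: "h \<in> carrier base" and c: "c \<in> carrier B"
    and k: "k = (h, c) \<otimes>\<^bsub>W\<^esub> (f, b) \<otimes>\<^bsub>W\<^esub> inv\<^bsub>W\<^esub> (h, c)"
    and eq: "comm_wreath.push A' B q B' (map_base p g) = comm_wreath.push A' B q B' (map_base p (fst k))"
      "q b = q (snd k)"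
  shows "q (c \<otimes>\<^bsub>B\<^esub> b) = q (b \<otimes>\<^bsub>B\<^esub> c)"
    and "x \<in> carrier B \<Longrightarrow>
      p (total g (orb (saturation q b) (c \<otimes>\<^bsub>B\<^esub> x))) = p (total f (orb (saturation q b) x))"
proof -
  interpret A': comm_group A' by fact
  interpret q: group_hom B B' q
    using assms(3) q B.group_axioms by (simp add: group_hom_def group_hom_axioms_def)
  interpret W': comm_wreath A' B
    using A'.comm_group_axioms A'.group_axioms B.group_axioms by (simp add: comm_wreath_def wreath_def)
  let ?d = "c \<otimes>\<^bsub>B\<^esub> b \<otimes>\<^bsub>B\<^esub> inv\<^bsub>B\<^esub> c" and ?K = "saturation q b"
  let ?g = "h \<otimes>\<^bsub>base\<^esub> shift B c f \<otimes>\<^bsub>base\<^esub> inv\<^bsub>base\<^esub> (shift B ?d h)"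
  have k': "fst k = ?g" "snd k = ?d"
    unfolding k conj_W[OF f b h c] by simp_all
  have dB: "?d \<in> carrier B" using b c by simp
  have gB: "?g \<in> carrier base"
    using h f c dB by (intro base.m_closed base.inv_closed shift_closed)
  have "?d \<otimes>\<^bsub>B\<^esub> c = c \<otimes>\<^bsub>B\<^esub> b"
    using b c by (simp add: B.m_assoc)
  then have "q b \<otimes>\<^bsub>B'\<^esub> q c = q c \<otimes>\<^bsub>B'\<^esub> q b"
    using q.hom_mult[OF dB c] q.hom_mult[OF c b] eq(2) unfolding k' by simp
  then show comm: "q (c \<otimes>\<^bsub>B\<^esub> b) = q (b \<otimes>\<^bsub>B\<^esub> c)"
    using b c by simp
  have K: "subgroup ?K B"
    by (rule saturation_subgroup[OF assms(3) q b])
  have dK: "?d \<in> ?K"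
    using dB eq(2)[unfolded k', symmetric] by (simp add: saturation_def generate.incl)
  have total_map: "p (total f' S) = W'.total (map_base p f') S"
    if "f' \<in> carrier base" "S \<subseteq> carrier B" for f' S
  proof -
    have "p (total f' S) = W'.total (\<lambda>x. p (f' x)) S"
      by (rule gfinprod_hom[OF A.comm_group_axioms assms(1) p base_Pi[OF that] finite_support_within[OF that]])
    also have "\<dots> = W'.total (map_base p f') S"
      using that hom_in_carrier[OF p] base_closed[OF that(1)]
      by (intro A'.gfinprod_cong) (auto simp: map_base_def simp_implies_def)
    finally show ?thesis .
  qed
  have vim: "{x \<in> carrier B. q x \<in> q ` orb ?K y} = orb ?K y" if y: "y \<in> carrier B" for y
    using y by (auto simp: orb_def saturation_def)
  have push_total: "p (total g (orb ?K y)) = p (total ?g (orb ?K y))" if y: "y \<in> carrier B" for y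
    using W'.total_vimage_if_push_eq[OF assms(3) q map_base_closed[OF W'.wreath_axioms p g]
        map_base_closed[OF W'.wreath_axioms p gB] eq(1)[unfolded k'], of "q ` orb ?K y"]
    by (simp add: vim[OF y] total_map[OF g orb_subset] total_map[OF gB orb_subset]
        del: mult_sum_group inv_sum_group)
  fix x assume x: "x \<in> carrier B"
  let ?y = "c \<otimes>\<^bsub>B\<^esub> x"
  have y: "?y \<in> carrier B" using c x by simp
  have "?g = (h \<otimes>\<^bsub>base\<^esub> inv\<^bsub>base\<^esub> (shift B ?d h)) \<otimes>\<^bsub>base\<^esub> shift B c f"
    using h f c dB by (simp add: base.m_ac shift_closed del: mult_sum_group inv_sum_group)
  then have "total ?g (orb ?K ?y) = \<one>\<^bsub>A\<^esub> \<otimes>\<^bsub>A\<^esub> total (shift B c f) (orb ?K ?y)"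
    using total_coboundary[OF K dK h y] h f c dB
    by (simp add: total_mult[OF _ _ orb_subset] shift_closed del: mult_sum_group inv_sum_group)
  also have "\<dots> = total f {z \<in> carrier B. c \<otimes>\<^bsub>B\<^esub> z \<in> orb ?K ?y}"
    using f c by (simp add: total_shift[OF f c orb_subset] total_closed)
  also have "{z \<in> carrier B. c \<otimes>\<^bsub>B\<^esub> z \<in> orb ?K ?y} = orb ?K x"
    using orb_saturation_translate[OF assms(3) q b c comm x] orb_subset by blast
  finally show "p (total g (orb ?K ?y)) = p (total f (orb ?K x))"
    using push_total[OF y] by (simp only:)
qed

end

section \<open>Separation over an abelian base\<close>

context comm_wreath
begin

text \<open>
  The quotient of \<open>g\<close> by the shifted \<open>f\<close> has trivial totals, so it is a coboundary.
\<close>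

lemma conj_if_totals_agree:
  assumes f: "f \<in> carrier base" and g: "g \<in> carrier base" and b: "b \<in> carrier B" and c: "c \<in> carrier B"
    and comm: "c \<otimes>\<^bsub>B\<^esub> b = b \<otimes>\<^bsub>B\<^esub> c"
    and eq: "\<And>x. x \<in> carrier B \<Longrightarrow>
      total g (orb (generate B {b}) (c \<otimes>\<^bsub>B\<^esub> x)) = total f (orb (generate B {b}) x)"
  shows "(g, b) \<in> conj_class W (f, b)"
proof -
  let ?H = "generate B {b}" and ?u = "g \<otimes>\<^bsub>base\<^esub> inv\<^bsub>base\<^esub> (shift B c f)"
  have H: "?H = saturation (\<lambda>x. x) b"
    using B.generate_in_carrier[of "{b}"] b by (auto simp: saturation_def)
  have "(\<lambda>x. x) \<in> hom B B"
    by (simp add: hom_def)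
  note translate = orb_saturation_translate[OF B.group_axioms this b c comm, folded H]
  have sf: "shift B c f \<in> carrier base"
    by (rule shift_closed[OF f c])
  have "total ?u (orb ?H y) = \<one>\<^bsub>A\<^esub>" if y: "y \<in> carrier B" for y
  proof -
    let ?x = "inv\<^bsub>B\<^esub> c \<otimes>\<^bsub>B\<^esub> y"
    have x: "?x \<in> carrier B" "c \<otimes>\<^bsub>B\<^esub> ?x = y"
      using c y by (simp_all flip: B.m_assoc)
    have "{z \<in> carrier B. c \<otimes>\<^bsub>B\<^esub> z \<in> orb ?H (c \<otimes>\<^bsub>B\<^esub> ?x)} = orb ?H ?x"
      using translate[OF x(1)] orb_subset[of ?H ?x] by blast
    then have "{z \<in> carrier B. c \<otimes>\<^bsub>B\<^esub> z \<in> orb ?H y} = orb ?H ?x"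
      unfolding x(2) .
    then have "total (shift B c f) (orb ?H y) = total f (orb ?H ?x)"
      using total_shift[OF f c orb_subset] by simp
    also have "\<dots> = total g (orb ?H y)"
      using eq[OF x(1)] unfolding x(2) by simp
    finally show ?thesis
      using g sf by (simp add: total_mult[OF _ _ orb_subset] total_inv[OF _ orb_subset]
          total_closed[OF _ orb_subset] del: mult_sum_group inv_sum_group)
  qed
  then have "?u \<in> coboundaries b"
    using g sf by (intro coboundary_if_totals_trivial[OF b]) (auto simp del: mult_sum_group inv_sum_group)
  then obtain h where h: "h \<in> carrier base" "?u = h \<otimes>\<^bsub>base\<^esub> inv\<^bsub>base\<^esub> (shift B b h)"
    by (auto simp: coboundaries_def)
  have sh: "shift B b h \<in> carrier base"
    by (rule shift_closed[OF h(1) b])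
  have "g \<otimes>\<^bsub>base\<^esub> shift B b h = ?u \<otimes>\<^bsub>base\<^esub> shift B b h \<otimes>\<^bsub>base\<^esub> shift B c f"
    using g sf sh by (simp add: base.m_ac del: mult_sum_group inv_sum_group one_sum_group)
  also have "\<dots> = h \<otimes>\<^bsub>base\<^esub> shift B c f"
    unfolding h(2) using h(1) sf sh by (simp add: base.m_assoc del: mult_sum_group inv_sum_group one_sum_group)
  finally have "(h, c) \<otimes>\<^bsub>W\<^esub> (f, b) = (g, b) \<otimes>\<^bsub>W\<^esub> (h, c)"
    by (simp add: mult_W comm del: mult_sum_group)
  then show ?thesis
    using f g b c h(1) by (subst mem_conj_class_iff[OF group_W]) (auto simp: carrier_W)
qed

lemma conj_class_abelian: "s \<in> carrier A \<Longrightarrow> conj_class A s = {s}"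
proof -
  assume s: "s \<in> carrier A"
  have "conj_class A s = (\<lambda>_. s) ` carrier A"
    unfolding conj_class_def
    by (intro image_cong) (use s in \<open>auto simp: A.m_comm[of _ s] A.m_assoc\<close>)
  then show ?thesis by auto
qed

text \<open>
  Conjugacy classes in the abelian group \<open>A\<close> are singletons, which gives the condition on \<open>V\<close>;
  separability of \<open>{\<one>}\<close> and of the cyclic subgroup in \<open>B\<close> give those on \<open>U\<close> and \<open>Y\<close>.
\<close>

lemma separating_homs:
  assumes C: "ext_closed_pseudovariety C" and A: "conjugacy_separable C A"
    and B: "conjugacy_separable C B" and cyc: "cyclic_subgroup_separable C B"
    and b: "b \<in> carrier B" and Y: "finite Y" "Y \<subseteq> carrier B" and U: "finite U" "U \<subseteq> carrier B"
    and V: "finite V" "V \<subseteq> carrier A"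
  obtains A' :: "'a set monoid" and p and B' :: "'b set monoid" and q
  where "in_class C A'" "comm_group A'" "p \<in> hom A A'" "in_class C B'" "q \<in> hom B B'"
    "\<And>s t. s \<in> V \<Longrightarrow> t \<in> V \<Longrightarrow> p s = p t \<Longrightarrow> s = t"
    "\<And>u. u \<in> U \<Longrightarrow> q u = \<one>\<^bsub>B'\<^esub> \<Longrightarrow> u = \<one>\<^bsub>B\<^esub>"
    "\<And>x y. x \<in> Y \<Longrightarrow> y \<in> Y \<Longrightarrow> y \<in> orb (saturation q b) x \<Longrightarrow> y \<in> orb (generate B {b}) x"
proof -
  let ?H = "generate B {b}"
  define IA where "IA = (\<Union>s\<in>V. \<Union>t\<in>V - {s}. {(s, {t})})"
  have sepA: "class_separable C A S \<and> s \<in> carrier A - S" if sS: "(s, S) \<in> IA" for s S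
  proof -
    obtain t where t: "S = {t}" "s \<in> V" "t \<in> V" "s \<noteq> t" using sS unfolding IA_def by blast
    then have "S = conj_class A t" using conj_class_abelian V(2) by auto
    then show ?thesis using A V(2) t by (auto simp: conjugacy_separable_def)
  qed
  have finA: "finite IA"
    using V(1) by (simp add: IA_def)
  obtain A' :: "'a set monoid" and p where A': "in_class C A'" "p \<in> hom A A'" "p ` carrier A = carrier A'"
    and p: "\<And>s S. (s, S) \<in> IA \<Longrightarrow> p s \<notin> p ` S"
    using simultaneous_separation[OF C A.group_axioms finA sepA] by metis
  define IB where "IB = (\<Union>x\<in>Y. \<Union>y\<in>{y \<in> Y. y \<otimes>\<^bsub>B\<^esub> inv\<^bsub>B\<^esub> x \<notin> ?H}. {(y \<otimes>\<^bsub>B\<^esub> inv\<^bsub>B\<^esub> x, ?H)})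
    \<union> (\<Union>u\<in>U - {\<one>\<^bsub>B\<^esub>}. {(u, {\<one>\<^bsub>B\<^esub>})})"
  have "class_separable C B {\<one>\<^bsub>B\<^esub>}"
    using B conj_class_one[OF B.group_axioms] B.one_closed unfolding conjugacy_separable_def by metis
  moreover have "class_separable C B ?H"
    using cyc b by (simp add: cyclic_subgroup_separable_def)
  ultimately have sepB: "class_separable C B S \<and> s \<in> carrier B - S" if "(s, S) \<in> IB" for s S
    using that Y(2) U(2) unfolding IB_def by (auto simp: subset_iff)
  have finB: "finite IB"
    using Y(1) U(1) by (simp add: IB_def)
  obtain B' :: "'b set monoid" and q where B': "in_class C B'" "q \<in> hom B B'"
    and q: "\<And>s S. (s, S) \<in> IB \<Longrightarrow> q s \<notin> q ` S"
    using simultaneous_separation[OF C B.group_axioms finB sepB] by metis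
  have q1: "q \<one>\<^bsub>B\<^esub> = \<one>\<^bsub>B'\<^esub>"
    using hom_one[OF B'(2) B.group_axioms in_class_group[OF B'(1)]] .
  show thesis
  proof (rule that)
    show "comm_group A'"
    proof (rule group.group_comm_groupI[OF in_class_group[OF A'(1)]])
      fix s t assume "s \<in> carrier A'" "t \<in> carrier A'"
      then obtain s' t' where "s' \<in> carrier A" "t' \<in> carrier A" "s = p s'" "t = p t'"
        unfolding A'(3)[symmetric] by blast
      then show "s \<otimes>\<^bsub>A'\<^esub> t = t \<otimes>\<^bsub>A'\<^esub> s"
        using hom_mult[OF A'(2)] A.m_comm by metis
    qed
    show "s = t" if st: "s \<in> V" "t \<in> V" "p s = p t" for s t
    proof (rule ccontr)
      assume "s \<noteq> t"
      then have "(s, {t}) \<in> IA" using st unfolding IA_def by blast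
      then show False using p st(3) by blast
    qed
    show "u = \<one>\<^bsub>B\<^esub>" if u: "u \<in> U" "q u = \<one>\<^bsub>B'\<^esub>" for u
    proof (rule ccontr)
      assume "u \<noteq> \<one>\<^bsub>B\<^esub>"
      then have "(u, {\<one>\<^bsub>B\<^esub>}) \<in> IB" using u unfolding IB_def by blast
      then have "q u \<notin> q ` {\<one>\<^bsub>B\<^esub>}" by (rule q)
      then show False using u(2) q1 by simp
    qed
    show "y \<in> orb ?H x" if xy: "x \<in> Y" "y \<in> Y" "y \<in> orb (saturation q b) x" for x y
    proof (rule ccontr)
      assume "y \<notin> orb ?H x"
      then have "(y \<otimes>\<^bsub>B\<^esub> inv\<^bsub>B\<^esub> x, ?H) \<in> IB" using xy Y(2) unfolding orb_def IB_def by blast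
      then have "q (y \<otimes>\<^bsub>B\<^esub> inv\<^bsub>B\<^esub> x) \<notin> q ` ?H" by (rule q)
      then show False using xy(3) unfolding orb_def saturation_def by blast
    qed
  qed (use A' B' in auto)
qed

text \<open>
  By \<open>sep\<close>, enlarging an orbit through \<open>Y\<close> to an orbit of the saturation adds no point of the support.
\<close>

lemma total_orb_saturation:
  assumes f: "f \<in> carrier base" and b: "b \<in> carrier B" and x: "x \<in> Y"
    and supp: "{y \<in> carrier B. f y \<noteq> \<one>\<^bsub>A\<^esub>} \<subseteq> Y"
    and sep: "\<And>x y. x \<in> Y \<Longrightarrow> y \<in> Y \<Longrightarrow> y \<in> orb (saturation q b) x \<Longrightarrow> y \<in> orb (generate B {b}) x"
  shows "total f (orb (saturation q b) x) = total f (orb (generate B {b}) x)"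
proof (rule total_support_cong[OF f orb_subset orb_subset])
  fix y assume y: "y \<in> carrier B" "f y \<noteq> \<one>\<^bsub>A\<^esub>"
  show "y \<in> orb (saturation q b) x \<longleftrightarrow> y \<in> orb (generate B {b}) x"
    using sep[OF x, of y] supp y generate_le_saturation[OF b, of q] by (auto simp: orb_def)
qed

text \<open>
  \<open>D\<close> contains the candidates for the top component of a conjugator: the elements moving a support
  point of \<open>f\<close> to one of \<open>g\<close>, and \<open>\<one>\<close> for the case that all totals of \<open>f\<close> over orbits of the
  saturation are trivial. A candidate \<open>c\<close> in the centraliser of \<open>b\<close> is refuted at the point \<open>z c\<close>; the
  commutators in \<open>U\<close> keep the others from commuting with \<open>b\<close> in the quotient.
\<close>

lemma separated_if_abelian:
  assumes C: "ext_closed_pseudovariety C" and A: "conjugacy_separable C A"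
    and B: "conjugacy_separable C B" and cyc: "cyclic_subgroup_separable C B"
    and f: "f \<in> carrier base" and g: "g \<in> carrier base" and b: "b \<in> carrier B"
    and nconj: "(g, b) \<notin> conj_class W (f, b)"
  shows "\<exists>N \<in> class_normal C W. N #>\<^bsub>W\<^esub> (g, b) \<notin> (\<lambda>x. N #>\<^bsub>W\<^esub> x) ` conj_class W (f, b)"
proof -
  let ?H = "generate B {b}" and ?Z = "{c \<in> carrier B. c \<otimes>\<^bsub>B\<^esub> b = b \<otimes>\<^bsub>B\<^esub> c}"
  let ?supp = "\<lambda>f. {x \<in> carrier B. f x \<noteq> \<one>\<^bsub>A\<^esub>}"
  have H: "subgroup ?H B"
    using b by (intro B.generate_is_subgroup) auto
  have "\<forall>c\<in>?Z. \<exists>x. x \<in> carrier B \<and> total g (orb ?H (c \<otimes>\<^bsub>B\<^esub> x)) \<noteq> total f (orb ?H x)"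
    using conj_if_totals_agree[OF f g b] nconj by blast
  from bchoice[OF this] obtain z where z: "\<And>c. c \<in> ?Z \<Longrightarrow> z c \<in> carrier B"
    "\<And>c. c \<in> ?Z \<Longrightarrow> total g (orb ?H (c \<otimes>\<^bsub>B\<^esub> z c)) \<noteq> total f (orb ?H (z c))"
    by blast
  define D where "D = insert \<one>\<^bsub>B\<^esub> ((\<lambda>(x, y). y \<otimes>\<^bsub>B\<^esub> inv\<^bsub>B\<^esub> x) ` (?supp f \<times> ?supp g))"
  have D: "finite D" "D \<subseteq> carrier B"
    using base_finite[OF f] base_finite[OF g] by (auto simp: D_def)
  define Y where "Y = ?supp f \<union> ?supp g \<union> z ` (D \<inter> ?Z) \<union> (\<lambda>c. c \<otimes>\<^bsub>B\<^esub> z c) ` (D \<inter> ?Z)"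
  have Y: "finite Y" "Y \<subseteq> carrier B"
    using base_finite[OF f] base_finite[OF g] D z(1) by (auto simp: Y_def)
  define V where "V = insert \<one>\<^bsub>A\<^esub> ((\<lambda>x. total f (orb ?H x)) ` Y \<union> (\<lambda>x. total g (orb ?H x)) ` Y)"
  have V: "finite V" "V \<subseteq> carrier A"
    using Y total_closed[OF f orb_subset] total_closed[OF g orb_subset] by (auto simp: V_def)
  define U where "U = (\<lambda>c. c \<otimes>\<^bsub>B\<^esub> b \<otimes>\<^bsub>B\<^esub> inv\<^bsub>B\<^esub> (b \<otimes>\<^bsub>B\<^esub> c)) ` D"
  have U: "finite U" "U \<subseteq> carrier B"
    using D b by (auto simp: U_def)
  obtain A' :: "'a set monoid" and p and B' :: "'b set monoid" and q
    where A': "in_class C A'" "comm_group A'" and p: "p \<in> hom A A'"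
      and B': "in_class C B'" and q: "q \<in> hom B B'"
      and sepV: "\<And>s t. s \<in> V \<Longrightarrow> t \<in> V \<Longrightarrow> p s = p t \<Longrightarrow> s = t"
      and sepU: "\<And>u. u \<in> U \<Longrightarrow> q u = \<one>\<^bsub>B'\<^esub> \<Longrightarrow> u = \<one>\<^bsub>B\<^esub>"
      and sepY: "\<And>x y. x \<in> Y \<Longrightarrow> y \<in> Y \<Longrightarrow> y \<in> orb (saturation q b) x \<Longrightarrow> y \<in> orb ?H x"
    by (rule separating_homs[OF C A B cyc b Y U V]) blast
  let ?K = "saturation q b"
  interpret A': comm_group A' by fact
  have grpB': "group B'" by (rule in_class_group[OF B'])
  interpret q: group_hom B B' q
    using q B.group_axioms grpB' by (simp add: group_hom_def group_hom_axioms_def)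
  interpret W': comm_wreath A' B
    using A'.comm_group_axioms A'.group_axioms B.group_axioms by (simp add: comm_wreath_def wreath_def)
  interpret W'': comm_wreath A' B'
    using A'.comm_group_axioms A'.group_axioms grpB' by (simp add: comm_wreath_def wreath_def)
  let ?p = "(\<lambda>(f, b). (W'.push q B' f, q b)) \<circ> (\<lambda>(f, b). (map_base p f, b))"
  have hom: "?p \<in> hom W W''.W"
    by (rule Group.hom_compose[OF map_base_hom[OF W'.wreath_axioms p] W'.push_hom[OF grpB' q]])
  have K: "subgroup ?K B"
    by (rule saturation_subgroup[OF grpB' q b])
  have totf: "total f (orb ?K x) = total f (orb ?H x)" and totg: "total g (orb ?K x) = total g (orb ?H x)"
    if "x \<in> Y" for x
    using total_orb_saturation[OF f b that _ sepY] total_orb_saturation[OF g b that _ sepY]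
    by (auto simp: Y_def)
  have fb: "(f, b) \<in> carrier W" "(g, b) \<in> carrier W"
    using f g b by (simp_all add: carrier_W)
  show ?thesis
  proof (rule hom_separates[OF C group_W conj_class_subset[OF group_W fb(1)]
        W''.in_class_W[OF C A'(1) B'] hom fb(2)])
    show "?p (g, b) \<notin> ?p ` conj_class W (f, b)"
    proof
      assume "?p (g, b) \<in> ?p ` conj_class W (f, b)"
      then obtain k' where k': "k' \<in> conj_class W (f, b)" "?p (g, b) = ?p k'"
        by (rule imageE)
      then obtain k where k: "k \<in> carrier W" "k' = k \<otimes>\<^bsub>W\<^esub> (f, b) \<otimes>\<^bsub>W\<^esub> inv\<^bsub>W\<^esub> k"
        unfolding conj_class_def by (blast elim: imageE)
      then obtain h c where h: "h \<in> carrier base" and c: "c \<in> carrier B" and hc: "k = (h, c)"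
        unfolding carrier_W by blast
      have eqs: "W'.push q B' (map_base p g) = W'.push q B' (map_base p (fst k'))" "q b = q (snd k')"
        using k'(2) by (simp_all add: case_prod_beta)
      note comm = totals_if_images_conj(1)[OF A'(2) p grpB' q f g b h c k(2)[unfolded hc] eqs]
      note tot = totals_if_images_conj(2)[OF A'(2) p grpB' q f g b h c k(2)[unfolded hc] eqs]
      have p1: "p \<one>\<^bsub>A\<^esub> = \<one>\<^bsub>A'\<^esub>"
        using hom_one[OF p A.group_axioms A'.group_axioms] .
      \<comment> \<open>replace \<open>c\<close>, known only up to the kernel of \<open>q\<close>, by a candidate that centralises \<open>b\<close> in \<open>B\<close>\<close>
      have "\<exists>c' \<in> D \<inter> ?Z. \<forall>x \<in> carrier B.
          p (total g (orb ?K (c' \<otimes>\<^bsub>B\<^esub> x))) = p (total f (orb ?K x))"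
      proof (cases "\<exists>x \<in> ?supp f. total f (orb ?K x) \<noteq> \<one>\<^bsub>A\<^esub>")
        case True
        then obtain x where x: "x \<in> ?supp f" "total f (orb ?K x) \<noteq> \<one>\<^bsub>A\<^esub>" by blast
        then have xB: "x \<in> carrier B" and xY: "x \<in> Y" by (auto simp: Y_def)
        have "total f (orb ?H x) \<in> V" "\<one>\<^bsub>A\<^esub> \<in> V"
          using xY by (auto simp: V_def)
        then have "p (total f (orb ?K x)) \<noteq> \<one>\<^bsub>A'\<^esub>"
          using sepV[of "total f (orb ?H x)" "\<one>\<^bsub>A\<^esub>"] x(2) totf[OF xY] p1 by auto
        then have "total g (orb ?K (c \<otimes>\<^bsub>B\<^esub> x)) \<noteq> \<one>\<^bsub>A\<^esub>"
          using tot[OF xB] p1 by metis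
        then obtain y where y: "y \<in> orb ?K (c \<otimes>\<^bsub>B\<^esub> x)" "g y \<noteq> \<one>\<^bsub>A\<^esub>"
          by (rule total_ne_one_support[OF g orb_subset])
        then have yB: "y \<in> carrier B" using orb_subset by blast
        let ?t = "y \<otimes>\<^bsub>B\<^esub> inv\<^bsub>B\<^esub> (c \<otimes>\<^bsub>B\<^esub> x)" and ?c = "y \<otimes>\<^bsub>B\<^esub> inv\<^bsub>B\<^esub> x"
        have t: "?t \<in> ?K" "?t \<in> carrier B"
          using y(1) yB c xB by (auto simp: orb_def)
        have c': "?c = ?t \<otimes>\<^bsub>B\<^esub> c" "?c \<in> carrier B"
          using c xB yB by (simp_all add: B.inv_mult_group B.m_assoc)
        have cD: "?c \<in> D"
          using x(1) y(2) yB by (auto simp: D_def)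
        obtain s where s: "s \<in> ?H" "q ?t = q s"
          using t(1) by (auto simp: saturation_def)
        have sB: "s \<in> carrier B"
          using s(1) subgroup.mem_carrier[OF H] by blast
        have "q b \<otimes>\<^bsub>B'\<^esub> q s = q s \<otimes>\<^bsub>B'\<^esub> q b"
          using hom_commutes_with_generated[OF grpB' q b b refl s(1)] b sB by simp
        moreover have "q c \<otimes>\<^bsub>B'\<^esub> q b = q b \<otimes>\<^bsub>B'\<^esub> q c"
          using comm b c by simp
        ultimately have "q s \<otimes>\<^bsub>B'\<^esub> q c \<otimes>\<^bsub>B'\<^esub> q b = q b \<otimes>\<^bsub>B'\<^esub> (q s \<otimes>\<^bsub>B'\<^esub> q c)"
          using b c sB by (metis q.H.m_assoc q.hom_closed)
        then have "q ?c \<otimes>\<^bsub>B'\<^esub> q b = q b \<otimes>\<^bsub>B'\<^esub> q ?c"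
          unfolding c'(1) q.hom_mult[OF t(2) c] s(2) .
        then have "q (?c \<otimes>\<^bsub>B\<^esub> b \<otimes>\<^bsub>B\<^esub> inv\<^bsub>B\<^esub> (b \<otimes>\<^bsub>B\<^esub> ?c)) = \<one>\<^bsub>B'\<^esub>"
          using b c'(2) q.hom_mult[OF c'(2) b] q.hom_mult[OF b c'(2)]
            q.hom_mult[of "?c \<otimes>\<^bsub>B\<^esub> b" "inv\<^bsub>B\<^esub> (b \<otimes>\<^bsub>B\<^esub> ?c)"] q.hom_inv[of "b \<otimes>\<^bsub>B\<^esub> ?c"]
          by (metis B.inv_closed B.m_closed q.H.r_inv q.hom_closed)
        then have "?c \<otimes>\<^bsub>B\<^esub> b \<otimes>\<^bsub>B\<^esub> inv\<^bsub>B\<^esub> (b \<otimes>\<^bsub>B\<^esub> ?c) = \<one>\<^bsub>B\<^esub>"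
          using cD by (intro sepU) (auto simp: U_def)
        then have cZ: "?c \<in> ?Z"
          using B.inv_solve_right[of "\<one>\<^bsub>B\<^esub>" "?c \<otimes>\<^bsub>B\<^esub> b" "b \<otimes>\<^bsub>B\<^esub> ?c"] b c'(2) by simp
        have "p (total g (orb ?K (?c \<otimes>\<^bsub>B\<^esub> w))) = p (total f (orb ?K w))" if w: "w \<in> carrier B" for w
        proof -
          have cw: "?c \<otimes>\<^bsub>B\<^esub> w = ?t \<otimes>\<^bsub>B\<^esub> (c \<otimes>\<^bsub>B\<^esub> w)"
            unfolding c'(1) using t(2) c w by (rule B.m_assoc)
          have "orb ?K (?c \<otimes>\<^bsub>B\<^esub> w) = orb ?K (c \<otimes>\<^bsub>B\<^esub> w)"
            unfolding cw using orb_translate(2)[OF K t(1) B.m_closed[OF c w]] orb_subset by blast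
          then show ?thesis using tot[OF w] by simp
        qed
        then show ?thesis using cD cZ by blast
      next
        case False
        have triv: "total f (orb ?K x) = \<one>\<^bsub>A\<^esub>" if x: "x \<in> carrier B" for x
        proof (rule ccontr)
          assume ne: "total f (orb ?K x) \<noteq> \<one>\<^bsub>A\<^esub>"
          then obtain y where y: "y \<in> orb ?K x" "f y \<noteq> \<one>\<^bsub>A\<^esub>"
            by (rule total_ne_one_support[OF f orb_subset])
          then have yB: "y \<in> carrier B" and t: "y \<otimes>\<^bsub>B\<^esub> inv\<^bsub>B\<^esub> x \<in> ?K"
            by (auto simp: orb_def)
          have "y = (y \<otimes>\<^bsub>B\<^esub> inv\<^bsub>B\<^esub> x) \<otimes>\<^bsub>B\<^esub> x"
            using x yB by (simp add: B.m_assoc)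
          moreover have "orb ?K ((y \<otimes>\<^bsub>B\<^esub> inv\<^bsub>B\<^esub> x) \<otimes>\<^bsub>B\<^esub> x) = orb ?K x"
            using orb_translate(2)[OF K t x] orb_subset by blast
          ultimately have "orb ?K y = orb ?K x" by simp
          then show False using False ne y(2) yB by auto
        qed
        have "p (total g (orb ?K (\<one>\<^bsub>B\<^esub> \<otimes>\<^bsub>B\<^esub> x))) = p (total f (orb ?K x))" if x: "x \<in> carrier B" for x
        proof -
          let ?x = "inv\<^bsub>B\<^esub> c \<otimes>\<^bsub>B\<^esub> x"
          have x': "?x \<in> carrier B" "c \<otimes>\<^bsub>B\<^esub> ?x = x"
            using x c by (simp_all flip: B.m_assoc)
          show ?thesis
            using tot[OF x'(1)] x triv[OF x] triv[OF x'(1)] unfolding x'(2) by simp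
        qed
        moreover have "\<one>\<^bsub>B\<^esub> \<in> D \<inter> ?Z" using b by (simp add: D_def)
        ultimately show ?thesis by blast
      qed
      then obtain c' where c': "c' \<in> D" "c' \<in> ?Z"
        and tot': "\<And>x. x \<in> carrier B \<Longrightarrow> p (total g (orb ?K (c' \<otimes>\<^bsub>B\<^esub> x))) = p (total f (orb ?K x))"
        by blast
      have zY: "z c' \<in> Y" "c' \<otimes>\<^bsub>B\<^esub> z c' \<in> Y"
        using c' by (auto simp: Y_def)
      then have "p (total g (orb ?H (c' \<otimes>\<^bsub>B\<^esub> z c'))) = p (total f (orb ?H (z c')))"
        using tot'[OF z(1)[OF c'(2)]] totf[OF zY(1)] totg[OF zY(2)] by simp
      then have "total g (orb ?H (c' \<otimes>\<^bsub>B\<^esub> z c')) = total f (orb ?H (z c'))"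
        using zY by (intro sepV) (auto simp: V_def)
      then show False using z(2)[OF c'(2)] by blast
    qed
  qed
qed

end

section \<open>Necessity of the conditions\<close>

context wreath
begin

lemma base_hom_W: "(\<lambda>f. (f, \<one>\<^bsub>B\<^esub>)) \<in> hom base W"
  by (auto simp: hom_def carrier_W mult_W shift_one simp del: mult_sum_group)

lemma conj_single_W:
  assumes "k \<in> carrier B" "x \<in> carrier B" "s \<in> carrier A"
  shows "(\<one>\<^bsub>base\<^esub>, k) \<otimes>\<^bsub>W\<^esub> (single x s, \<one>\<^bsub>B\<^esub>) \<otimes>\<^bsub>W\<^esub> inv\<^bsub>W\<^esub> (\<one>\<^bsub>base\<^esub>, k) = (single (k \<otimes>\<^bsub>B\<^esub> x) s, \<one>\<^bsub>B\<^esub>)"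
  using assms
  by (simp add: conj_W single_closed shift_single shift_base_one del: one_sum_group mult_sum_group inv_sum_group)

text \<open>
  If \<open>s\<close> and \<open>t\<close> do not commute, separability of the class \<open>{\<one>}\<close> gives a homomorphism \<open>r\<close> under which their
  copies at \<open>\<one>\<close> do not commute. It is injective on \<open>B\<close>: if \<open>r\<close> killed \<open>k \<noteq> \<one>\<close>, the copy of \<open>s\<close> at \<open>\<one>\<close>
  would have the same image as its copy at \<open>k\<close>, which commutes with the copy of \<open>t\<close> at \<open>\<one>\<close>.
\<close>

lemma in_class_or_base_abelian:
  assumes C: "ext_closed_pseudovariety C" and sep: "conjugacy_separable C W"
  shows "in_class C B \<or> comm_group A"
proof (rule disjCI)
  assume "\<not> comm_group A"
  then obtain s t where s: "s \<in> carrier A" and t: "t \<in> carrier A" and st: "s \<otimes>\<^bsub>A\<^esub> t \<noteq> t \<otimes>\<^bsub>A\<^esub> s"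
    using A.group_comm_groupI by blast
  interpret W: group W by (rule group_W)
  let ?d = "\<lambda>x s. (single x s, \<one>\<^bsub>B\<^esub>)"
  have dW: "?d x s' \<in> carrier W" if "s' \<in> carrier A" for x s'
    using that by (simp add: carrier_W single_closed)
  let ?v = "?d \<one>\<^bsub>B\<^esub> s \<otimes>\<^bsub>W\<^esub> ?d \<one>\<^bsub>B\<^esub> t" and ?w = "?d \<one>\<^bsub>B\<^esub> t \<otimes>\<^bsub>W\<^esub> ?d \<one>\<^bsub>B\<^esub> s"
  have vw: "?v \<in> carrier W" "?w \<in> carrier W"
    using dW s t by auto
  have "fst ?v \<one>\<^bsub>B\<^esub> \<noteq> fst ?w \<one>\<^bsub>B\<^esub>"
    using s t st by (simp add: mult_W shift_one single_closed mult_base del: mult_sum_group) (simp add: single_def)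
  then have "?v \<noteq> ?w" by metis
  then have "?v \<otimes>\<^bsub>W\<^esub> inv\<^bsub>W\<^esub> ?w \<noteq> \<one>\<^bsub>W\<^esub>"
    using vw W.inv_solve_right[of "\<one>\<^bsub>W\<^esub>" ?v ?w] by auto
  moreover have "class_separable C W {\<one>\<^bsub>W\<^esub>}"
    using sep conj_class_one[OF group_W] W.one_closed unfolding conjugacy_separable_def by metis
  moreover define I where "I = {(?v \<otimes>\<^bsub>W\<^esub> inv\<^bsub>W\<^esub> ?w, {\<one>\<^bsub>W\<^esub>})}"
  ultimately have I: "finite I" "\<And>g S. (g, S) \<in> I \<Longrightarrow> class_separable C W S \<and> g \<in> carrier W - S"
    using vw by auto
  obtain Q :: "(('b \<Rightarrow> 'a) \<times> 'b) set monoid" and r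
    where Q: "in_class C Q" and r: "r \<in> hom W Q"
      and r_sep: "\<And>g S. (g, S) \<in> I \<Longrightarrow> r g \<notin> r ` S"
    using simultaneous_separation[OF C group_W I] by metis
  interpret r: group_hom W Q r
    using r group_W in_class_group[OF Q] by (simp add: group_hom_def group_hom_axioms_def)
  have "r (?v \<otimes>\<^bsub>W\<^esub> inv\<^bsub>W\<^esub> ?w) \<noteq> \<one>\<^bsub>Q\<^esub>"
    using r_sep[of "?v \<otimes>\<^bsub>W\<^esub> inv\<^bsub>W\<^esub> ?w" "{\<one>\<^bsub>W\<^esub>}"] by (simp add: I_def)
  then have neq: "r ?v \<noteq> r ?w"
    using vw by auto
  let ?i = "\<lambda>b. (\<one>\<^bsub>base\<^esub>, b)"
  have i: "r \<circ> ?i \<in> hom B Q"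
    by (rule Group.hom_compose[OF embed_hom_W r])
  interpret i: group_hom B Q "r \<circ> ?i"
    using i B.group_axioms in_class_group[OF Q] by (simp add: group_hom_def group_hom_axioms_def)
  show "in_class C B"
  proof (rule in_class_if_embeds[OF C Q B.group_axioms i], rule ccontr)
    assume "\<not> inj_on (r \<circ> ?i) (carrier B)"
    then obtain k where k: "k \<in> carrier B" "k \<noteq> \<one>\<^bsub>B\<^esub>" "r (?i k) = \<one>\<^bsub>Q\<^esub>"
      using i.inj_on_one_iff by auto
    have ik: "?i k \<in> carrier W"
      using k(1) by (simp add: carrier_W del: one_sum_group)
    have "r (?d k s) = r (?i k \<otimes>\<^bsub>W\<^esub> ?d \<one>\<^bsub>B\<^esub> s \<otimes>\<^bsub>W\<^esub> inv\<^bsub>W\<^esub> ?i k)"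
      using conj_single_W[OF k(1) B.one_closed s] k(1) by (simp del: one_sum_group)
    also have "\<dots> = r (?d \<one>\<^bsub>B\<^esub> s)"
      using ik dW[OF s] k(3) by (simp del: one_sum_group)
    finally have rk: "r (?d \<one>\<^bsub>B\<^esub> s) = r (?d k s)" by simp
    have "single k s \<otimes>\<^bsub>base\<^esub> single \<one>\<^bsub>B\<^esub> t = single \<one>\<^bsub>B\<^esub> t \<otimes>\<^bsub>base\<^esub> single k s"
      using s t k(2) by (auto simp: single_def fun_eq_iff)
    then have "?d k s \<otimes>\<^bsub>W\<^esub> ?d \<one>\<^bsub>B\<^esub> t = ?d \<one>\<^bsub>B\<^esub> t \<otimes>\<^bsub>W\<^esub> ?d k s"
      using s t by (simp add: mult_W shift_one single_closed del: mult_sum_group)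
    then have "r (?d k s) \<otimes>\<^bsub>Q\<^esub> r (?d \<one>\<^bsub>B\<^esub> t) = r (?d \<one>\<^bsub>B\<^esub> t) \<otimes>\<^bsub>Q\<^esub> r (?d k s)"
      using r.hom_mult[OF dW[OF s] dW[OF t]] r.hom_mult[OF dW[OF t] dW[OF s]] by metis
    then have "r ?v = r ?w"
      unfolding r.hom_mult[OF dW[OF s] dW[OF t]] r.hom_mult[OF dW[OF t] dW[OF s]] rk .
    with neq show False by contradiction
  qed
qed

end

text \<open>
  If a homomorphism \<open>r\<close> on \<open>W\<close> identified \<open>x\<close> with some \<open>t\<close> in the subgroup generated by \<open>b\<close>, it
  would also identify \<open>(f\<^sub>x, b)\<close> with \<open>(f\<^sub>t, b)\<close>, where \<open>f\<^sub>y\<close> is the product of the copy of \<open>s\<close> at \<open>\<one>\<close>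
  and the inverse of its copy at \<open>y\<close>. The latter is conjugate to \<open>(\<one>, b)\<close>, because \<open>f\<^sub>t\<close> is a
  coboundary, whereas \<open>f\<^sub>x\<close> has a non-trivial total.
\<close>

lemma (in comm_wreath) cyclic_subgroup_separable_if_separable:
  assumes C: "ext_closed_pseudovariety C" and sep: "conjugacy_separable C W"
    and s: "s \<in> carrier A" "s \<noteq> \<one>\<^bsub>A\<^esub>"
  shows "cyclic_subgroup_separable C B"
  unfolding cyclic_subgroup_separable_def class_separable_def
proof (intro ballI conjI)
  fix b assume b: "b \<in> carrier B"
  let ?H = "generate B {b}"
  have H: "subgroup ?H B"
    using b by (intro B.generate_is_subgroup) auto
  show HB: "?H \<subseteq> carrier B"
    using subgroup.subset[OF H] .
  fix x assume x: "x \<in> carrier B - ?H"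
  interpret W: group W by (rule group_W)
  let ?f = "\<lambda>x. single \<one>\<^bsub>B\<^esub> s \<otimes>\<^bsub>base\<^esub> inv\<^bsub>base\<^esub> (single x s)"
  have fB: "?f y \<in> carrier base" for y
    using single_closed[OF s(1)] by (simp del: mult_sum_group inv_sum_group)
  let ?i = "\<lambda>b. (\<one>\<^bsub>base\<^esub>, b)"
  have iW: "?i y \<in> carrier W" if "y \<in> carrier B" for y
    using that by (simp add: carrier_W del: one_sum_group)
  have conj_i: "(h, c) \<otimes>\<^bsub>W\<^esub> ?i b \<otimes>\<^bsub>W\<^esub> inv\<^bsub>W\<^esub> (h, c) =
      (h \<otimes>\<^bsub>base\<^esub> inv\<^bsub>base\<^esub> (shift B (c \<otimes>\<^bsub>B\<^esub> b \<otimes>\<^bsub>B\<^esub> inv\<^bsub>B\<^esub> c) h), c \<otimes>\<^bsub>B\<^esub> b \<otimes>\<^bsub>B\<^esub> inv\<^bsub>B\<^esub> c)"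
    if "h \<in> carrier base" "c \<in> carrier B" for h c
    using that b by (simp add: conj_W shift_base_one del: one_sum_group mult_sum_group inv_sum_group)
  have "(?f x, b) \<notin> conj_class W (?i b)"
  proof
    assume "(?f x, b) \<in> conj_class W (?i b)"
    then obtain h c where h: "h \<in> carrier base" and c: "c \<in> carrier B"
      and eq: "(?f x, b) = (h, c) \<otimes>\<^bsub>W\<^esub> ?i b \<otimes>\<^bsub>W\<^esub> inv\<^bsub>W\<^esub> (h, c)"
      unfolding conj_class_def carrier_W by blast
    have "?f x = h \<otimes>\<^bsub>base\<^esub> inv\<^bsub>base\<^esub> (shift B b h)"
      using eq unfolding conj_i[OF h c] by (metis prod.inject)
    moreover have "b \<in> ?H" by (simp add: generate.incl)
    ultimately have "total (?f x) (orb ?H \<one>\<^bsub>B\<^esub>) = \<one>\<^bsub>A\<^esub>"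
      using total_coboundary[OF H _ h B.one_closed] by metis
    moreover have "\<one>\<^bsub>B\<^esub> \<in> orb ?H \<one>\<^bsub>B\<^esub>" "x \<notin> orb ?H \<one>\<^bsub>B\<^esub>"
      using x subgroup.one_closed[OF H] by (auto simp: orb_def)
    then have "total (?f x) (orb ?H \<one>\<^bsub>B\<^esub>) = s"
      using x s single_closed[OF s(1)]
      by (simp add: total_mult total_inv total_single orb_subset del: mult_sum_group inv_sum_group)
    ultimately show False using s(2) by simp
  qed
  moreover have "class_separable C W (conj_class W (?i b))"
    using sep iW[OF b] by (simp add: conjugacy_separable_def del: one_sum_group)
  moreover have "(?f x, b) \<in> carrier W"
    using fB b by (simp add: carrier_W del: mult_sum_group inv_sum_group)
  moreover define I where "I = {((?f x, b), conj_class W (?i b))}"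
  ultimately have I: "finite I" "\<And>g S. (g, S) \<in> I \<Longrightarrow> class_separable C W S \<and> g \<in> carrier W - S"
    by auto
  obtain Q :: "(('b \<Rightarrow> 'a) \<times> 'b) set monoid" and r
    where Q: "in_class C Q" and r: "r \<in> hom W Q"
      and r_sep: "\<And>g S. (g, S) \<in> I \<Longrightarrow> r g \<notin> r ` S"
    using simultaneous_separation[OF C group_W I] by metis
  have r_neq: "r (?f x, b) \<notin> r ` conj_class W (?i b)"
    using r_sep by (simp add: I_def)
  interpret r: group_hom W Q r
    using r group_W in_class_group[OF Q] by (simp add: group_hom_def group_hom_axioms_def)
  interpret j: group_hom base W "\<lambda>f. (f, \<one>\<^bsub>B\<^esub>)"
    using base_hom_W base.group_axioms group_W by (simp add: group_hom_def group_hom_axioms_def)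
  let ?d = "\<lambda>y. (single y s, \<one>\<^bsub>B\<^esub>)"
  have dW: "?d y \<in> carrier W" for y
    using s(1) by (simp add: carrier_W single_closed)
  have r_f: "r (?f y, b) = r (?d \<one>\<^bsub>B\<^esub>) \<otimes>\<^bsub>Q\<^esub> inv\<^bsub>Q\<^esub> (r (?i y) \<otimes>\<^bsub>Q\<^esub> r (?d \<one>\<^bsub>B\<^esub>) \<otimes>\<^bsub>Q\<^esub> inv\<^bsub>Q\<^esub> (r (?i y))) \<otimes>\<^bsub>Q\<^esub> r (?i b)"
    if y: "y \<in> carrier B" for y
  proof -
    have "(?f y, b) = (?f y, \<one>\<^bsub>B\<^esub>) \<otimes>\<^bsub>W\<^esub> ?i b"
      using fB b by (simp add: mult_W shift_base_one del: mult_sum_group one_sum_group inv_sum_group)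
    also have "(?f y, \<one>\<^bsub>B\<^esub>) = ?d \<one>\<^bsub>B\<^esub> \<otimes>\<^bsub>W\<^esub> inv\<^bsub>W\<^esub> (?d y)"
      using single_closed[OF s(1)] j.hom_mult j.hom_inv by (metis base.inv_closed)
    also have "?d y = ?i y \<otimes>\<^bsub>W\<^esub> ?d \<one>\<^bsub>B\<^esub> \<otimes>\<^bsub>W\<^esub> inv\<^bsub>W\<^esub> (?i y)"
      using conj_single_W[OF y B.one_closed s(1)] y by (simp del: one_sum_group)
    finally show ?thesis
      using iW[OF y] iW[OF b] dW[of "\<one>\<^bsub>B\<^esub>"]
      by (simp del: one_sum_group mult_sum_group inv_sum_group)
  qed
  have "r (?i x) \<noteq> r (?i t)" if t: "t \<in> ?H" for t
  proof
    assume eq: "r (?i x) = r (?i t)"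
    have tB: "t \<in> carrier B" using t HB by blast
    have "?f t \<in> coboundaries b"
      using single_move_coboundary[OF b s(1) t B.one_closed] tB by (simp del: mult_sum_group inv_sum_group)
    then obtain h where h: "h \<in> carrier base" "?f t = h \<otimes>\<^bsub>base\<^esub> inv\<^bsub>base\<^esub> (shift B b h)"
      unfolding coboundaries_def by blast
    have "(?f t, b) = (h, \<one>\<^bsub>B\<^esub>) \<otimes>\<^bsub>W\<^esub> ?i b \<otimes>\<^bsub>W\<^esub> inv\<^bsub>W\<^esub> (h, \<one>\<^bsub>B\<^esub>)"
      unfolding conj_i[OF h(1) B.one_closed] h(2) using b by simp
    moreover have "(h, \<one>\<^bsub>B\<^esub>) \<in> carrier W"
      using h(1) by (simp add: carrier_W)
    ultimately have "(?f t, b) \<in> conj_class W (?i b)"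
      unfolding conj_class_def by blast
    moreover have "r (?f x, b) = r (?f t, b)"
      using r_f[of x] r_f[OF tB] x unfolding eq by simp
    ultimately show False using r_neq by blast
  qed
  then have "(r \<circ> ?i) x \<notin> (r \<circ> ?i) ` ?H"
    by auto
  then show "\<exists>N\<in>class_normal C B. N #>\<^bsub>B\<^esub> x \<notin> (\<lambda>x. N #>\<^bsub>B\<^esub> x) ` ?H"
    using x by (intro hom_separates[OF C B.group_axioms HB Q Group.hom_compose[OF embed_hom_W r]]) auto
qed

theorem theorem1:
  fixes C :: "nat monoid set" and A :: "'a monoid" and B :: "'b monoid"
  assumes "ext_closed_pseudovariety C"
    and "group A" and "group B"
    and "conjugacy_separable C A" and "conjugacy_separable C B"
  shows "(in_class C B \<or> (comm_group A \<and> cyclic_subgroup_separable C B)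
            \<longrightarrow> conjugacy_separable C (wreath_product A B)) \<and>
         (\<not> trivial_group A \<longrightarrow> conjugacy_separable C (wreath_product A B)
            \<longrightarrow> in_class C B \<or> (comm_group A \<and> cyclic_subgroup_separable C B))"
proof (intro conjI impI)
  interpret wreath A B
    using assms(2,3) by (simp add: wreath_def)
  show "conjugacy_separable C W"
    if cond: "in_class C B \<or> (comm_group A \<and> cyclic_subgroup_separable C B)"
  proof (rule conjugacy_separable_W[OF assms(1,5)])
    fix f g b
    assume fgb: "f \<in> carrier base" "g \<in> carrier base" "b \<in> carrier B" "(g, b) \<notin> conj_class W (f, b)"
    show "\<exists>N \<in> class_normal C W. N #>\<^bsub>W\<^esub> (g, b) \<notin> (\<lambda>x. N #>\<^bsub>W\<^esub> x) ` conj_class W (f, b)"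
    proof (cases "in_class C B")
      case True
      then show ?thesis
        using separable_if_top_in_class[OF assms(1,4) _ fgb] by blast
    next
      case False
      with cond have "comm_group A" "cyclic_subgroup_separable C B" by auto
      then interpret comm_wreath A B
        using wreath_axioms by (simp add: comm_wreath_def)
      show ?thesis
        using separated_if_abelian[OF assms(1,4,5) \<open>cyclic_subgroup_separable C B\<close> fgb] .
    qed
  qed
  show "in_class C B \<or> (comm_group A \<and> cyclic_subgroup_separable C B)"
    if nontriv: "\<not> trivial_group A" and sep: "conjugacy_separable C W"
  proof (cases "in_class C B")
    case False
    then have comm: "comm_group A"
      using in_class_or_base_abelian[OF assms(1) sep] by blast
    then interpret comm_wreath A B
      using wreath_axioms by (simp add: comm_wreath_def)
    obtain s where "s \<in> carrier A" "s \<noteq> \<one>\<^bsub>A\<^esub>"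
      using nontriv A.group_axioms A.one_closed by (auto simp: trivial_group_def)
    then show ?thesis
      using comm cyclic_subgroup_separable_if_separable[OF assms(1) sep] by blast
  qed simp
qed

end
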